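(* Let $\frac32\le q<\infty$, let $A:\ell^q(\mathbb N)\to\ell^2(\mathbb N)$ be the diagonal operator $Ae_n=\lambda_ne_n$ and $\mathcal R=\frac1q\|\cdot\|_{\ell^q}^q$. There is a threshold $\bar c=\bar c(q)>0$ such that the following holds. Let $x^\dagger$ satisfy the source condition: there is $w\in\ell^2(\mathbb N)$ with $\xi:=A^*w\in\partial\mathcal R(x^\dagger)$. For noisy data $y^\delta$ with $\|y^\delta-y\|\le\delta$, let $\alpha_*=\alpha_*(y^\delta)$ be selected by the Hanke-Raus rule, i.e. as a minimiser over $(0,\alpha_{\max})$ of $\psi_{\rm HR}(\alpha,y^\delta)=\frac1\alpha\langle y^\delta-Ax^{II}_{\alpha,\delta},y^\delta-Ax^\delta_\alpha\rangle$, and suppose $\delta^*:=\|Ax^\delta_{\alpha_*}-y^\delta\|\ne0$. Suppose that there are constants $0<C_1\le\bar c$ (i.e. $C_1$ sufficiently small) and $C_2>0$ such that for all noisy data $y^\delta$ and all $\alpha\in(0,\alpha_{\max})$, with $m_n:=\max\{|y_n|,|y^\delta_n|\}$, $$\sum_{\{n:\ \frac{\lambda_n^q}{\alpha}m_n^{2-q}\ge C_1\}}|y_n-y_n^\delta|^2\,m_n^{q-2}\,\frac{\alpha}{\lambda_n^q}\ \le\ C_2\sum_{\{n:\ \frac{\lambda_n^q}{\alpha}m_n^{2-q}<C_1\}}|y_n-y_n^\delta|^2 .$$ Then $$D_\xi(x^\delta_{\alpha_*},x^\dagger)\to0\qquad\text{as }\delta\to0.$$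
   Context: $\{e_n\}_{n\in\mathbb N}$ is the standard basis, and $\{\lambda_n\}$ is a sequence of real numbers, $\lambda_n>0$, monotonically decaying to $0$, such that $A$ is a continuous linear operator from $X=\ell^q(\mathbb N)$ to $Y=\ell^2(\mathbb N)$; $A^*$ is its adjoint $Y\to X^*$. $\alpha_{\max}>0$ is fixed. $y=\{y_n\}\in Y$ is exact data, $y^\delta=\{y_n^\delta\}\in Y$ noisy data given for each $\delta>0$, and $x^\dagger\in X$ is an $\mathcal R$-minimising solution: $Ax^\dagger=y$ and $\mathcal R(x^\dagger)=\min\{\mathcal R(x):Ax=y\}$. For $\eta\in\partial\mathcal R(x_2)$, $D_\eta(x_1,x_2)=\mathcal R(x_1)-\mathcal R(x_2)-\langle\eta,x_1-x_2\rangle_{X^*\times X}$ is the Bregman distance. For $\alpha\in(0,\alpha_{\max})$, $x^\delta_\alpha$ is the minimiser over $x\in X$ of $\frac12\|Ax-y^\delta\|^2+\alpha\mathcal R(x)$, $\xi^\delta_\alpha=-\frac1\alpha A^*(Ax^\delta_\alpha-y^\delta)\in\partial\mathcal R(x^\delta_\alpha)$, and the second Bregman iterate $x^{II}_{\alpha,\delta}$ is the minimiser of $\frac12\|Ax-y^\delta\|^2+\alpha D_{\xi^\delta_\alpha}(x,x^\delta_\alpha)$. Terms in the sums with $y_n=y_n^\delta=0$ are read as $0$. *)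

theory Defs
  imports "HOL-Analysis.Analysis"
begin

section \<open>Sequence spaces\<close>

text \<open>
  The exponent is a real parameter and cannot index a type, so the spaces are carrier sets of
  real sequences. For functions, the library's pointwise \<open>-\<close> gives the difference of sequences.
\<close>

definition lq :: "real \<Rightarrow> (nat \<Rightarrow> real) set" where
  "lq q = {x. summable (\<lambda>n. \<bar>x n\<bar> powr q)}"

definition lq_norm :: "real \<Rightarrow> (nat \<Rightarrow> real) \<Rightarrow> real" where
  "lq_norm q x = (\<Sum>n. \<bar>x n\<bar> powr q) powr (1 / q)"

definition l2_inner :: "(nat \<Rightarrow> real) \<Rightarrow> (nat \<Rightarrow> real) \<Rightarrow> real" where
  "l2_inner u v = (\<Sum>n. u n * v n)"

definition unit_seq :: "nat \<Rightarrow> nat \<Rightarrow> real" where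
  "unit_seq n = (\<lambda>k. if k = n then 1 else 0)"

definition bounded_operator ::
    "real \<Rightarrow> real \<Rightarrow> ((nat \<Rightarrow> real) \<Rightarrow> nat \<Rightarrow> real) \<Rightarrow> bool" where
  "bounded_operator p q A \<longleftrightarrow>
     (\<forall>x\<in>lq p. A x \<in> lq q) \<and>
     (\<forall>x\<in>lq p. \<forall>z\<in>lq p. A (\<lambda>n. x n + z n) = (\<lambda>n. A x n + A z n)) \<and>
     (\<forall>x\<in>lq p. \<forall>c. A (\<lambda>n. c * x n) = (\<lambda>n. c * A x n)) \<and>
     (\<exists>K. \<forall>x\<in>lq p. lq_norm q (A x) \<le> K * lq_norm p x)"

text \<open>
  The dual space consists of bounded linear functionals; application is the duality pairing.
  Values off the carrier are irrelevant: functionals are only ever applied to elements of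
  \<open>lq q\<close>. No identification with the conjugate sequence space is made.
\<close>

definition lq_dual :: "real \<Rightarrow> ((nat \<Rightarrow> real) \<Rightarrow> real) set" where
  "lq_dual q = {f.
     (\<forall>x\<in>lq q. \<forall>z\<in>lq q. f (\<lambda>n. x n + z n) = f x + f z) \<and>
     (\<forall>x\<in>lq q. \<forall>c. f (\<lambda>n. c * x n) = c * f x) \<and>
     (\<exists>K. \<forall>x\<in>lq q. \<bar>f x\<bar> \<le> K * lq_norm q x)}"

text \<open>The adjoint of an operator into \<open>lq 2\<close>, with \<open>lq 2\<close> identified with its own dual.\<close>

definition dual_adjoint ::
    "((nat \<Rightarrow> real) \<Rightarrow> nat \<Rightarrow> real) \<Rightarrow> (nat \<Rightarrow> real) \<Rightarrow> ((nat \<Rightarrow> real) \<Rightarrow> real)" where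
  "dual_adjoint A w = (\<lambda>x. l2_inner w (A x))"


section \<open>Convex analysis\<close>

definition reg :: "real \<Rightarrow> (nat \<Rightarrow> real) \<Rightarrow> real" where
  "reg q x = 1 / q * lq_norm q x powr q"

definition subdiff :: "real \<Rightarrow> (nat \<Rightarrow> real) \<Rightarrow> ((nat \<Rightarrow> real) \<Rightarrow> real) set" where
  "subdiff q x = {\<eta> \<in> lq_dual q. \<forall>z\<in>lq q. reg q x + \<eta> (z - x) \<le> reg q z}"

definition bregman ::
    "real \<Rightarrow> ((nat \<Rightarrow> real) \<Rightarrow> real) \<Rightarrow> (nat \<Rightarrow> real) \<Rightarrow> (nat \<Rightarrow> real) \<Rightarrow> real" where
  "bregman q \<eta> x1 x2 = reg q x1 - reg q x2 - \<eta> (x1 - x2)"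


section \<open>Tikhonov regularisation and the Hanke-Raus functional\<close>

text \<open>
  For \<open>\<alpha> > 0\<close>, \<open>q > 1\<close> both functionals below are coercive and strictly convex on \<open>lq q\<close>, so the
  minimiser exists, is unique, and is the value of \<open>arg_min_on\<close>.
\<close>

definition tikhonov ::
    "((nat \<Rightarrow> real) \<Rightarrow> nat \<Rightarrow> real) \<Rightarrow> real \<Rightarrow> (nat \<Rightarrow> real) \<Rightarrow> real \<Rightarrow> nat \<Rightarrow> real" where
  "tikhonov A q yd \<alpha> =
     arg_min_on (\<lambda>x. 1 / 2 * (lq_norm 2 (A x - yd))\<^sup>2 + \<alpha> * reg q x) (lq q)"

definition tikhonov_subgrad ::
    "((nat \<Rightarrow> real) \<Rightarrow> nat \<Rightarrow> real) \<Rightarrow> real \<Rightarrow> (nat \<Rightarrow> real) \<Rightarrow> real \<Rightarrow> (nat \<Rightarrow> real) \<Rightarrow> real" where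
  "tikhonov_subgrad A q yd \<alpha> =
     (\<lambda>x. - (1 / \<alpha>) * dual_adjoint A (A (tikhonov A q yd \<alpha>) - yd) x)"

definition bregman_iterate2 ::
    "((nat \<Rightarrow> real) \<Rightarrow> nat \<Rightarrow> real) \<Rightarrow> real \<Rightarrow> (nat \<Rightarrow> real) \<Rightarrow> real \<Rightarrow> nat \<Rightarrow> real" where
  "bregman_iterate2 A q yd \<alpha> =
     arg_min_on
       (\<lambda>x. 1 / 2 * (lq_norm 2 (A x - yd))\<^sup>2
            + \<alpha> * bregman q (tikhonov_subgrad A q yd \<alpha>) x (tikhonov A q yd \<alpha>))
       (lq q)"

definition psi_HR ::
    "((nat \<Rightarrow> real) \<Rightarrow> nat \<Rightarrow> real) \<Rightarrow> real \<Rightarrow> (nat \<Rightarrow> real) \<Rightarrow> real \<Rightarrow> real" where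
  "psi_HR A q yd \<alpha> =
     1 / \<alpha> * l2_inner (yd - A (bregman_iterate2 A q yd \<alpha>)) (yd - A (tikhonov A q yd \<alpha>))"


section \<open>Noise condition\<close>

text \<open>
  Indices with \<open>y n = yd n = 0\<close> contribute \<open>0\<close> to either sum, whatever \<open>0 powr (2 - q)\<close> means,
  because of the factor \<open>\<bar>y n - yd n\<bar>\<^sup>2\<close>. Both families are summable for \<open>y, yd \<in> lq 2\<close> and
  \<open>C1, \<alpha>, lam n > 0\<close>: on the left the summands are at most \<open>\<bar>y n - yd n\<bar>\<^sup>2 / C1\<close>.
\<close>

definition noise_condition ::
    "real \<Rightarrow> (nat \<Rightarrow> real) \<Rightarrow> real \<Rightarrow> real \<Rightarrow> (nat \<Rightarrow> real) \<Rightarrow> (nat \<Rightarrow> real) \<Rightarrow> real \<Rightarrow> bool" where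
  "noise_condition q lam C1 C2 y yd \<alpha> \<longleftrightarrow>
     (let m = (\<lambda>n. max \<bar>y n\<bar> \<bar>yd n\<bar>) in
       (\<Sum>\<^sub>\<infinity>n\<in>{n. lam n powr q / \<alpha> * m n powr (2 - q) \<ge> C1}.
           \<bar>y n - yd n\<bar>\<^sup>2 * m n powr (q - 2) * (\<alpha> / lam n powr q))
       \<le> C2 * (\<Sum>\<^sub>\<infinity>n\<in>{n. lam n powr q / \<alpha> * m n powr (2 - q) < C1}. \<bar>y n - yd n\<bar>\<^sup>2))"

end

theory Submission
  imports Defs
begin

text \<open>
  Since \<open>A\<close> is diagonal, both minimisation problems decouple. With \<open>c = \<alpha> / \<lambda>\<^sub>n\<^sup>q\<close> and
  \<open>J t = sgn t \<bar>t\<bar>\<^sup>q\<^sup>-\<^sup>1\<close> (\<open>spow (q - 1)\<close> below), the entries \<open>p\<close>, \<open>p\<^sub>2\<close> of \<open>A x\<close> for the Tikhonov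
  minimiser and the second Bregman iterate solve \<open>p + c J p = b\<close> and \<open>p\<^sub>2 + c J p\<^sub>2 = 2 b - p\<close>,
  where \<open>b\<close> is the noisy datum. Then \<open>\<alpha> \<psi>\<close> is the sum of the terms \<open>(b - p) (b - p\<^sub>2) \<ge> 0\<close>, each at
  least a constant times \<open>\<theta>\<^sup>3 b\<^sup>2 / (1 + K \<theta>)\<^sup>3\<close>, \<open>\<theta> = c \<bar>b\<bar>\<^sup>q\<^sup>-\<^sup>2\<close>. The source condition reads
  \<open>c J y = \<alpha> w\<^sub>n\<close>.

  Where \<open>\<theta>\<close> (with the maximum of \<open>\<bar>y\<bar>\<close> and \<open>\<bar>b\<bar>\<close> in place of \<open>\<bar>b\<bar>\<close>) is large, the squared noise is
  controlled by the terms of \<open>\<alpha> \<psi>\<close> if \<open>\<bar>y\<bar> \<le> \<bar>b\<bar>\<close>, and by \<open>\<alpha>\<^sup>2 w\<^sub>n\<^sup>2\<close> otherwise. Where it is bounded,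
  the Bregman error is at most a constant times \<open>\<theta> (b - y)\<^sup>2 + \<alpha>\<^sup>2 w\<^sub>n\<^sup>2\<close>, and the noise condition moves
  the first part to the other indices. Altogether \<open>D \<le> const (\<psi>(\<alpha>) + \<alpha> \<parallel>w\<parallel>\<^sup>2)\<close>.

  Comparing with the choice \<open>\<alpha> = \<delta>\<close> gives \<open>\<psi>(\<alpha>\<^sub>*) = O(\<delta>)\<close>. If \<open>y = 0\<close> then \<open>w = 0\<close>; otherwise the
  lower bound at a single index with \<open>y\<^sub>n \<noteq> 0\<close> forces \<open>\<alpha>\<^sub>*\<^sup>2 = O(\<delta>)\<close>.
\<close>

section \<open>Signed powers and the scalar shrinkage equation\<close>

text \<open>For \<open>1 < q\<close>, \<open>spow (q - 1)\<close> is the derivative of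
  \<open>\<bar>t\<bar> powr q / q\<close>, hence the coordinate form of the subgradient of
  \<open>reg q\<close>.\<close>

definition spow :: "real \<Rightarrow> real \<Rightarrow> real" where
  "spow r t = sgn t * \<bar>t\<bar> powr r"

lemma spow_minus [simp]: "spow r (- t) = - spow r t"
  by (simp add: spow_def sgn_minus)

lemma spow_0 [simp]: "spow r 0 = 0"
  by (simp add: spow_def)

lemma spow_nonneg_eq: "0 \<le> t \<Longrightarrow> spow r t = t powr r"
  by (cases "t = 0") (auto simp: spow_def)

lemma abs_spow: "\<bar>spow r t\<bar> = \<bar>t\<bar> powr r"
  by (cases "t = 0") (auto simp: spow_def abs_mult abs_sgn_eq)

lemma mult_spow: "t * spow r t = \<bar>t\<bar> powr (r + 1)"
  by (cases "t = 0") (auto simp: spow_def powr_add sgn_if)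

lemma spow_mult_pos: "0 < a \<Longrightarrow> spow r (a * t) = a powr r * spow r t"
  by (simp add: spow_def sgn_mult abs_mult powr_mult)

section \<open>Mean-value bounds for real powers\<close>

text \<open>Weighted arithmetic-geometric mean inequality for \<open>u\<close> and 1 with weights
  \<open>r\<close> and \<open>1 - r\<close>.\<close>

lemma powr_le_tangent:
  fixes u :: real
  assumes "0 < r" "r \<le> 1" "0 \<le> u"
  shows "u powr r \<le> 1 + r * (u - 1)"
proof (cases "u = 0")
  case False
  then show ?thesis
    using Youngs_inequality_0[of r "1 - r" u 1] assms by (simp add: algebra_simps)
qed (use assms in auto)

text \<open>For \<open>r \<le> 1\<close> one bound is the tangent inequality and the other is
  \<open>u \<le> u powr r\<close>. For \<open>1 < r\<close> the roles swap, with the tangent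
  inequality taken for exponent \<open>1 / r\<close> at the point \<open>u powr r\<close>.\<close>

lemma one_minus_powr_bounds:
  fixes u :: real
  assumes r: "0 < r" and u: "0 \<le> u" "u \<le> 1"
  shows "min r 1 * (1 - u) \<le> 1 - u powr r" "1 - u powr r \<le> max 1 r * (1 - u)"
proof -
  have *: "u \<le> u powr s" if "0 < s" "s \<le> 1" for s
    using powr_mono'[of s 1 u] u that by simp
  have "min r 1 * (1 - u) \<le> 1 - u powr r \<and> 1 - u powr r \<le> max 1 r * (1 - u)"
  proof (cases "r \<le> 1")
    case True
    with powr_le_tangent[of r u] *[of r] r u show ?thesis
      by (simp add: algebra_simps)
  next
    case False
    have "(u powr r) powr (1 / r) \<le> 1 + (1 / r) * (u powr r - 1)"
      using False by (intro powr_le_tangent) auto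
    then have "u \<le> 1 + (1 / r) * (u powr r - 1)"
      using r u by (simp add: powr_powr)
    then have "r * u \<le> r * (1 + (1 / r) * (u powr r - 1))"
      using r by (intro mult_left_mono) auto
    then have "r * u \<le> r + u powr r - 1"
      using r by (simp add: algebra_simps)
    moreover have "u powr r \<le> u"
      using powr_mono'[of 1 r u] u False by simp
    ultimately show ?thesis using False by (simp add: algebra_simps)
  qed
  then show "min r 1 * (1 - u) \<le> 1 - u powr r" "1 - u powr r \<le> max 1 r * (1 - u)" by auto
qed

text \<open>Homogeneity reduces this to the previous lemma with \<open>u = t / s\<close>. The factor
  is evaluated at the larger endpoint \<open>s\<close>, so it stays bounded for \<open>r < 1\<close>
  as \<open>t\<close> approaches 0.\<close>

lemma powr_diff_bounds:
  fixes s t :: real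
  assumes r: "0 < r" and t: "0 \<le> t" "t \<le> s"
  shows "min r 1 * s powr (r - 1) * (s - t) \<le> s powr r - t powr r"
    and "s powr r - t powr r \<le> max 1 r * s powr (r - 1) * (s - t)"
proof -
  have "min r 1 * s powr (r - 1) * (s - t) \<le> s powr r - t powr r \<and>
    s powr r - t powr r \<le> max 1 r * s powr (r - 1) * (s - t)"
  proof (cases "s = 0")
    case False
    then have s: "0 < s" using t by simp
    define u where "u = t / s"
    have u: "0 \<le> u" "u \<le> 1" "t = u * s" using s t by (auto simp: u_def)
    have 1: "s powr r = s powr (r - 1) * s"
      using s by (simp add: powr_diff)
    have 2: "s powr r - t powr r = s powr r * (1 - u powr r)"
      using u s by (simp add: powr_mult algebra_simps)
    have 3: "a * s powr (r - 1) * (s - t) = s powr r * (a * (1 - u))" for a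
      unfolding u(3) 1 by (simp add: algebra_simps)
    show ?thesis
      unfolding 2 3 using one_minus_powr_bounds[OF r u(1,2)]
      by (intro conjI mult_left_mono) auto
  qed (use t r in auto)
  then show "min r 1 * s powr (r - 1) * (s - t) \<le> s powr r - t powr r"
    "s powr r - t powr r \<le> max 1 r * s powr (r - 1) * (s - t)" by auto
qed

lemma spow_mono:
  assumes "0 < r" "s \<le> t"
  shows "spow r s \<le> spow r t"
proof -
  consider "0 \<le> s" | "s < 0" "0 \<le> t" | "t < 0" by linarith
  then show ?thesis
  proof cases
    case 1 with assms show ?thesis by (simp add: spow_nonneg_eq powr_mono2)
  next
    case 2
    then have "0 \<le> spow r t" "0 \<le> spow r (- s)" by (simp_all add: spow_nonneg_eq del: spow_minus)
    then show ?thesis by simp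
  next
    case 3
    then have "spow r (- t) \<le> spow r (- s)"
      using assms by (simp add: spow_nonneg_eq powr_mono2 del: spow_minus)
    then show ?thesis by simp
  qed
qed

lemma continuous_spow:
  assumes "0 < r"
  shows "continuous_on UNIV (spow r)"
proof -
  have "spow r = (\<lambda>t. max t 0 powr r - max (- t) 0 powr r)"
    by (auto simp: fun_eq_iff spow_def sgn_if max_def)
  then show ?thesis
    using assms by (auto intro!: continuous_intros continuous_on_powr')
qed

text \<open>By symmetry and oddness the argument of larger modulus may be taken nonnegative. Equal
  signs are covered by the mean-value bound. For opposite signs the triangle inequality costs the
  factor 2, and \<open>\<bar>s - t\<bar>\<close> is at least the larger modulus.\<close>

lemma spow_diff_le:
  assumes r: "0 < r"
  shows "\<bar>spow r s - spow r t\<bar> \<le> max 2 r * max \<bar>s\<bar> \<bar>t\<bar> powr (r - 1) * \<bar>s - t\<bar>"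
proof -
  have pos: "\<bar>spow r s - spow r t\<bar> \<le> max 2 r * s powr (r - 1) * \<bar>s - t\<bar>"
    if st: "0 \<le> s" "\<bar>t\<bar> \<le> s" for s t
  proof (cases "0 \<le> t")
    case True
    have "\<bar>spow r s - spow r t\<bar> = s powr r - t powr r"
      using True st r powr_mono2[of r t s] by (simp add: spow_nonneg_eq)
    also have "\<dots> \<le> max 1 r * s powr (r - 1) * (s - t)"
      using True st r by (intro powr_diff_bounds) auto
    also have "\<dots> \<le> max 2 r * s powr (r - 1) * (s - t)"
      using st by (intro mult_right_mono) auto
    finally show ?thesis using st by simp
  next
    case False
    have "\<bar>spow r s - spow r t\<bar> \<le> \<bar>spow r s\<bar> + \<bar>spow r t\<bar>" by simp
    also have "\<dots> \<le> 2 * s powr r"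
      using st r powr_mono2[of r "\<bar>t\<bar>" s] by (simp add: abs_spow)
    also have "s powr r = s powr (r - 1) * s"
      using st False by (simp add: powr_diff)
    also have "2 * (s powr (r - 1) * s) \<le> max 2 r * s powr (r - 1) * \<bar>s - t\<bar>"
      using st False by (subst mult.assoc, intro mult_mono) auto
    finally show ?thesis .
  qed
  have gen: "\<bar>spow r s - spow r t\<bar> \<le> max 2 r * \<bar>s\<bar> powr (r - 1) * \<bar>s - t\<bar>"
    if "\<bar>t\<bar> \<le> \<bar>s\<bar>" for s t
  proof (cases "0 \<le> s")
    case True then show ?thesis using pos[of s t] that by simp
  next
    case False
    then have "\<bar>spow r (-s) - spow r (-t)\<bar> \<le> max 2 r * (-s) powr (r - 1) * \<bar>-s - -t\<bar>"
      using that by (intro pos) auto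
    moreover have "\<bar>spow r (-s) - spow r (-t)\<bar> = \<bar>spow r s - spow r t\<bar>" "\<bar>-s - -t\<bar> = \<bar>s - t\<bar>"
      by auto
    ultimately show ?thesis using False by simp
  qed
  show ?thesis
  proof (cases "\<bar>t\<bar> \<le> \<bar>s\<bar>")
    case True then show ?thesis using gen[of t s] by (simp add: max_absorb1)
  next
    case False then show ?thesis using gen[of s t]
      by (simp add: max_absorb2 abs_minus_commute)
  qed
qed

section \<open>Subgradients of the scalar penalty\<close>

text \<open>Young's inequality for \<open>\<bar>x\<bar> powr (q - 1)\<close> and
  \<open>\<bar>z\<bar>\<close> with conjugate exponents \<open>q'\<close> and \<open>q\<close>, so
  no derivative is computed.\<close>

lemma powr_tangent_le:
  assumes q: "1 < q"
  shows "\<bar>x\<bar> powr q / q + spow (q - 1) x * (z - x) \<le> \<bar>z\<bar> powr q / q"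
proof -
  define q' where "q' = q / (q - 1)"
  have q': "1 < q'" "1 / q' + 1 / q = 1" "(q - 1) * q' = q"
    using q by (auto simp: q'_def field_simps)
  have "spow (q - 1) x * z \<le> \<bar>spow (q - 1) x * z\<bar>" by simp
  also have "\<dots> = \<bar>x\<bar> powr (q - 1) * \<bar>z\<bar>" by (simp add: abs_mult abs_spow)
  also have "\<dots> \<le> (\<bar>x\<bar> powr (q - 1)) powr q' / q' + \<bar>z\<bar> powr q / q"
    using q' q by (intro Youngs_inequality) auto
  also have "(\<bar>x\<bar> powr (q - 1)) powr q' = \<bar>x\<bar> powr q"
    using q' by (simp add: powr_powr)
  also have "\<bar>x\<bar> powr q / q' = \<bar>x\<bar> powr q - \<bar>x\<bar> powr q / q"
  proof -
    have "1 / q' = 1 - 1 / q" using q' by simp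
    then show ?thesis by (metis mult.right_neutral right_diff_distrib times_divide_eq_right)
  qed
  finally have "spow (q - 1) x * z \<le> \<bar>x\<bar> powr q - \<bar>x\<bar> powr q / q + \<bar>z\<bar> powr q / q" .
  moreover have "spow (q - 1) x * (z - x) = spow (q - 1) x * z - \<bar>x\<bar> powr q"
  proof -
    have "spow (q - 1) x * (z - x) = spow (q - 1) x * z - x * spow (q - 1) x"
      by (simp add: left_diff_distrib mult.commute)
    then show ?thesis by (simp add: mult_spow)
  qed
  ultimately show ?thesis by linarith
qed

text \<open>Adding the tangent inequality at \<open>x + t\<close>, evaluated back at
  \<open>x\<close>, to the hypothesis gives \<open>b * t \<le> spow (q - 1) (x + t) * t\<close>.
  Dividing by \<open>t\<close> and letting \<open>t\<close> tend to 0 from either side squeezes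
  \<open>b\<close>, by continuity of \<open>spow\<close>.\<close>

lemma tangent_unique:
  assumes q: "1 < q"
    and sub: "\<And>t. \<bar>x\<bar> powr q / q + b * t \<le> \<bar>x + t\<bar> powr q / q"
  shows "b = spow (q - 1) x"
proof -
  have tan: "b * t \<le> spow (q - 1) (x + t) * t" for t
    using powr_tangent_le[OF q, of "x + t" x] sub[of t] by simp
  have cont: "((\<lambda>t. spow (q - 1) (x + t)) \<longlongrightarrow> spow (q - 1) (x + 0)) (at 0 within A)" for A
  proof -
    have "isCont (spow (q - 1)) (x + 0)"
      using continuous_spow[of "q - 1"] q by (simp add: continuous_on_eq_continuous_at)
    then show ?thesis
      by (rule isCont_tendsto_compose) (intro tendsto_intros)
  qed
  have "b \<le> spow (q - 1) (x + 0)"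
  proof (rule tendsto_lowerbound[OF cont])
    show "\<forall>\<^sub>F t in at_right 0. b \<le> spow (q - 1) (x + t)"
      using eventually_at_right_less
    proof eventually_elim
      case (elim t)
      then show ?case using tan[of t] by simp
    qed
  qed simp
  moreover have "spow (q - 1) (x + 0) \<le> b"
  proof (rule tendsto_upperbound[OF cont])
    have "\<forall>\<^sub>F t in at_left (0::real). t < 0"
      by (auto simp: eventually_at_filter)
    then show "\<forall>\<^sub>F t in at_left 0. spow (q - 1) (x + t) \<le> b"
    proof eventually_elim
      case (elim t)
      then show ?case using tan[of t] by simp
    qed
  qed simp
  ultimately show ?thesis by simp
qed

section \<open>The scalar equation \<open>p + c * spow r p = b\<close>\<close>

text \<open>The solution is the proximal point of \<open>b\<close> for the penalty
  \<open>c * \<bar>p\<bar> powr (r + 1) / (r + 1)\<close>. The intermediate value theorem applies on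
  the interval between \<open>- \<bar>b\<bar>\<close> and \<open>\<bar>b\<bar>\<close>.\<close>

lemma ex_shrink:
  assumes "0 < r" "0 < c"
  shows "\<exists>p. p + c * spow r p = b"
proof -
  have cont: "continuous_on {- \<bar>b\<bar>..\<bar>b\<bar>} (\<lambda>p. p + c * spow r p)"
    by (intro continuous_intros continuous_on_subset[OF continuous_spow[OF assms(1)]]) auto
  have "0 \<le> spow r \<bar>b\<bar>" by (simp add: spow_nonneg_eq)
  then have *: "0 \<le> c * spow r \<bar>b\<bar>" using assms by simp
  have "- \<bar>b\<bar> + c * spow r (- \<bar>b\<bar>) \<le> b" "b \<le> \<bar>b\<bar> + c * spow r \<bar>b\<bar>"
    using * unfolding spow_minus by linarith+
  from IVT'[OF this _ cont] show ?thesis by auto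
qed

lemma shrink_mono:
  assumes "0 < r" "0 < c" "p + c * spow r p \<le> p' + c * spow r p'"
  shows "p \<le> p'"
proof (rule ccontr)
  assume "\<not> p \<le> p'"
  moreover from this have "c * spow r p' \<le> c * spow r p"
    using assms by (intro mult_left_mono spow_mono) auto
  ultimately show False using assms by linarith
qed

text \<open>Both \<open>p\<close> and \<open>c * spow r p\<close> move in the same direction, so
  neither increment exceeds their sum: the proximal map and its complement are nonexpansive.\<close>

lemma shrink_diff:
  assumes "0 < r" "0 < c"
  shows "\<bar>p - p'\<bar> \<le> \<bar>(p + c * spow r p) - (p' + c * spow r p')\<bar>"
    and "\<bar>c * spow r p - c * spow r p'\<bar> \<le> \<bar>(p + c * spow r p) - (p' + c * spow r p')\<bar>"
proof -
  have "p \<le> p' \<and> c * spow r p \<le> c * spow r p' \<or> p' \<le> p \<and> c * spow r p' \<le> c * spow r p"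
    using assms spow_mono[of r] by (metis linear mult_left_mono less_imp_le)
  then show "\<bar>p - p'\<bar> \<le> \<bar>(p + c * spow r p) - (p' + c * spow r p')\<bar>"
    "\<bar>c * spow r p - c * spow r p'\<bar> \<le> \<bar>(p + c * spow r p) - (p' + c * spow r p')\<bar>"
    by linarith+
qed

lemma shrink_abs_le:
  assumes "0 < r" "0 < c" "p + c * spow r p = b"
  shows "\<bar>p\<bar> \<le> \<bar>b\<bar>" "\<bar>c * spow r p\<bar> \<le> \<bar>b\<bar>"
  using shrink_diff[OF assms(1,2), of p 0] assms(3) by simp_all

section \<open>Bounds for one term of the Hanke-Raus functional\<close>

text \<open>For \<open>0 \<le> b\<close> monotonicity gives
  \<open>0 \<le> p \<le> p2 \<le> b\<close>, hence the first two bounds. The residuals are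
  \<open>b - p = c * spow r p\<close> and \<open>b - p2 = c * (spow r p2 - spow r p)\<close>;
  replacing \<open>spow r p\<close> in the first and \<open>spow r p2\<close> in the second by
  \<open>spow r b\<close> through the mean-value bounds yields \<open>g1\<close> and
  \<open>g2\<close>. Using \<open>g1\<close> twice and \<open>g2\<close> once produces the cubes.
  Oddness covers \<open>b < 0\<close>.\<close>

lemma hanke_raus_term_bounds:
  fixes b p p2 c r :: real
  assumes r: "0 < r" and c: "0 < c"
    and p: "p + c * spow r p = b" and p2: "p2 + c * spow r p2 = 2 * b - p"
  defines "\<theta> \<equiv> c * \<bar>b\<bar> powr (r - 1)"
  shows "0 \<le> (b - p) * (b - p2)"
    and "(b - p) * (b - p2) \<le> (b - p)\<^sup>2"
    and "min r 1 * \<theta> ^ 3 * b\<^sup>2 \<le> (b - p) * (b - p2) * (1 + max 2 r * \<theta>) ^ 3"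
proof -
  have main: "0 \<le> (b - p) * (b - p2) \<and> (b - p) * (b - p2) \<le> (b - p)\<^sup>2 \<and>
      min r 1 * (c * b powr (r - 1)) ^ 3 * b\<^sup>2
        \<le> (b - p) * (b - p2) * (1 + max 2 r * (c * b powr (r - 1))) ^ 3"
    if p: "p + c * spow r p = b" and p2: "p2 + c * spow r p2 = 2 * b - p" and b: "0 \<le> b"
    for b p p2
  proof -
    define \<theta> where "\<theta> = c * b powr (r - 1)"
    define K where "K = max 2 r"
    have "0 \<le> spow r b" using b by (simp add: spow_nonneg_eq)
    then have cb: "0 \<le> c * spow r b" using c by simp
    have "0 \<le> p" by (rule shrink_mono[OF r c]) (use p b in simp)
    have "p \<le> b" by (rule shrink_mono[OF r c]) (use p cb in simp)
    have pb: "c * spow r p \<le> c * spow r b"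
      using \<open>p \<le> b\<close> c r by (intro mult_left_mono spow_mono) auto
    have "p \<le> p2" by (rule shrink_mono[OF r c]) (use p p2 \<open>p \<le> b\<close> in simp)
    have "p2 \<le> b" by (rule shrink_mono[OF r c]) (use p p2 pb in simp)
    have \<theta>: "0 \<le> \<theta>" using c by (simp add: \<theta>_def)
    have K: "0 < K" by (simp add: K_def)
    have up: "c * (spow r b - spow r s) \<le> K * \<theta> * (b - s)" if "0 \<le> s" "s \<le> b" for s
    proof -
      have "spow r b - spow r s \<le> max 1 r * b powr (r - 1) * (b - s)"
        using powr_diff_bounds(2)[OF r that] that b by (simp add: spow_nonneg_eq)
      also have "\<dots> \<le> K * b powr (r - 1) * (b - s)"
        using that by (intro mult_right_mono) (auto simp: K_def)
      finally have "c * (spow r b - spow r s) \<le> c * (K * b powr (r - 1) * (b - s))"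
        using c by (intro mult_left_mono) auto
      then show ?thesis by (simp add: \<theta>_def mult_ac)
    qed
    have low: "min r 1 * \<theta> * (b - p) \<le> c * (spow r b - spow r p)"
    proof -
      have "c * (min r 1 * b powr (r - 1) * (b - p)) \<le> c * (spow r b - spow r p)"
        using powr_diff_bounds(1)[OF r \<open>0 \<le> p\<close> \<open>p \<le> b\<close>] c \<open>0 \<le> p\<close> b
        by (intro mult_left_mono) (auto simp: spow_nonneg_eq)
      then show ?thesis by (simp add: \<theta>_def mult_ac)
    qed
    have cb\<theta>: "c * spow r b = \<theta> * b"
      using b by (cases "b = 0") (simp_all add: \<theta>_def spow_nonneg_eq powr_diff)
    have g1: "\<theta> * b \<le> (b - p) * (1 + K * \<theta>)"
      using up[OF \<open>0 \<le> p\<close> \<open>p \<le> b\<close>] p cb\<theta> by (simp add: algebra_simps)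
    have g2: "min r 1 * \<theta> * (b - p) \<le> (b - p2) * (1 + K * \<theta>)"
      using up[of p2] low p p2 \<open>0 \<le> p\<close> \<open>p \<le> p2\<close> \<open>p2 \<le> b\<close> by (simp add: algebra_simps)
    have "min r 1 * \<theta> ^ 3 * b\<^sup>2 = min r 1 * \<theta> * (\<theta> * b)\<^sup>2"
      by (simp add: power2_eq_square power3_eq_cube)
    also have "\<dots> \<le> min r 1 * \<theta> * ((b - p) * (1 + K * \<theta>))\<^sup>2"
      using g1 \<theta> b r by (intro mult_left_mono power_mono) auto
    also have "\<dots> = (min r 1 * \<theta> * (b - p)) * ((b - p) * (1 + K * \<theta>)\<^sup>2)"
      by (simp add: power2_eq_square)
    also have "\<dots> \<le> ((b - p2) * (1 + K * \<theta>)) * ((b - p) * (1 + K * \<theta>)\<^sup>2)"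
      using g2 \<open>p \<le> b\<close> by (intro mult_right_mono) auto
    also have "\<dots> = (b - p) * (b - p2) * (1 + K * \<theta>) ^ 3"
      by (simp add: power2_eq_square power3_eq_cube)
    finally have "min r 1 * \<theta> ^ 3 * b\<^sup>2 \<le> (b - p) * (b - p2) * (1 + K * \<theta>) ^ 3" .
    moreover have "(b - p) * (b - p2) \<le> (b - p)\<^sup>2"
      unfolding power2_eq_square using \<open>p \<le> b\<close> \<open>p \<le> p2\<close> by (intro mult_left_mono) auto
    ultimately show ?thesis using \<open>p \<le> b\<close> \<open>p2 \<le> b\<close> by (auto simp: \<theta>_def K_def)
  qed
  have "0 \<le> (b - p) * (b - p2) \<and> (b - p) * (b - p2) \<le> (b - p)\<^sup>2 \<and>
      min r 1 * \<theta> ^ 3 * b\<^sup>2 \<le> (b - p) * (b - p2) * (1 + max 2 r * \<theta>) ^ 3"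
  proof (cases "0 \<le> b")
    case True
    then show ?thesis using main[OF p p2] by (simp add: \<theta>_def)
  next
    case False
    have *: "(-p) + c * spow r (-p) = -b" "(-p2) + c * spow r (-p2) = 2 * (-b) - (-p)"
      using p p2 by auto
    have eqs: "(- b - - p) * (- b - - p2) = (b - p) * (b - p2)" "(- b - - p)\<^sup>2 = (b - p)\<^sup>2"
      by (simp_all add: power2_eq_square algebra_simps)
    have "\<bar>b\<bar> = - b" "0 \<le> - b" "(- b)\<^sup>2 = b\<^sup>2" using False by auto
    then show ?thesis using main[OF *] unfolding eqs \<theta>_def by simp
  qed
  then show "0 \<le> (b - p) * (b - p2)" "(b - p) * (b - p2) \<le> (b - p)\<^sup>2"
    "min r 1 * \<theta> ^ 3 * b\<^sup>2 \<le> (b - p) * (b - p2) * (1 + max 2 r * \<theta>) ^ 3" by auto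
qed

section \<open>Scalar bounds for the Bregman error and the noise\<close>

lemma sq_diff_le: "(a - b)\<^sup>2 \<le> 2 * a\<^sup>2 + 2 * b\<^sup>2" for a b :: real
  using zero_le_power2[of "a + b"] by (simp add: power2_eq_square algebra_simps)

lemma sq_le_of_abs_diff_le:
  fixes a d v :: real
  assumes "\<bar>a - v\<bar> \<le> \<bar>d - v\<bar>"
  shows "a\<^sup>2 \<le> 2 * d\<^sup>2 + 8 * v\<^sup>2"
proof -
  have "\<bar>a\<bar> \<le> \<bar>d\<bar> + 2 * \<bar>v\<bar>" using assms by linarith
  then have "\<bar>a\<bar>\<^sup>2 \<le> (\<bar>d\<bar> - - (2 * \<bar>v\<bar>))\<^sup>2" by (intro power_mono) auto
  also have "\<dots> \<le> 2 * \<bar>d\<bar>\<^sup>2 + 2 * (- (2 * \<bar>v\<bar>))\<^sup>2" by (rule sq_diff_le)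
  finally show ?thesis by (simp add: power_mult_distrib)
qed

text \<open>
  If \<open>\<bar>p\<bar>\<close> and \<open>\<bar>y\<bar>\<close> are both below half the maximum of \<open>\<bar>y\<bar>\<close> and \<open>\<bar>b\<bar>\<close>, the mean-value bound is useless
  for \<open>q < 2\<close>, but then the noise \<open>b - y\<close> is itself of the size of that maximum.
\<close>

lemma shrink_bregman_large:
  fixes b p y c q :: real
  assumes q: "1 < q" and c: "0 < c" and p: "p + c * spow (q - 1) p = b"
    and T: "c * max \<bar>y\<bar> \<bar>b\<bar> powr (q - 2) \<le> T" and m: "0 < max \<bar>y\<bar> \<bar>b\<bar>"
  shows "(c * spow (q - 1) p - c * spow (q - 1) y) * (p - y)
    \<le> 16 * max 2 (q - 1) * (c * max \<bar>y\<bar> \<bar>b\<bar> powr (q - 2) * (b - y)\<^sup>2)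
      + 4 * max 2 (q - 1) * T * (c * spow (q - 1) y)\<^sup>2"
proof -
  define K where "K = max 2 (q - 1)"
  define m where "m = max \<bar>y\<bar> \<bar>b\<bar>"
  define M where "M = max \<bar>p\<bar> \<bar>y\<bar>"
  define \<theta> where "\<theta> = c * m powr (q - 2)"
  define u where "u = c * spow (q - 1) y"
  have r: "0 < q - 1" using q by simp
  have K: "0 < K" by (simp add: K_def)
  have \<theta>: "0 \<le> \<theta>" "\<theta> \<le> T" using c T by (simp_all add: \<theta>_def m_def)
  have M: "0 \<le> M" "M \<le> m" "\<bar>p\<bar> \<le> M" "\<bar>y\<bar> \<le> M"
    using shrink_abs_le(1)[OF r c p] by (auto simp: M_def m_def)
  have m0: "0 < m" using m by (simp add: m_def)
  have T0: "0 \<le> K * T * u\<^sup>2" "0 \<le> K * (\<theta> * (b - y)\<^sup>2)"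
    using K \<theta> by (auto intro!: mult_nonneg_nonneg)
  have f: "(c * spow (q - 1) p - c * spow (q - 1) y) * (p - y) \<le> K * (c * M powr (q - 2)) * (p - y)\<^sup>2"
  proof -
    have "(spow (q - 1) p - spow (q - 1) y) * (p - y) \<le> \<bar>spow (q - 1) p - spow (q - 1) y\<bar> * \<bar>p - y\<bar>"
      unfolding abs_mult[symmetric] by (rule abs_ge_self)
    also have "\<dots> \<le> (K * M powr (q - 2) * \<bar>p - y\<bar>) * \<bar>p - y\<bar>"
      using spow_diff_le[OF r, of p y] unfolding K_def M_def diff_diff_eq one_add_one
      by (intro mult_right_mono abs_ge_zero)
    also have "\<dots> = K * M powr (q - 2) * (p - y)\<^sup>2"
      by (simp add: power2_eq_square mult.assoc)
    finally have "c * ((spow (q - 1) p - spow (q - 1) y) * (p - y)) \<le> c * (K * M powr (q - 2) * (p - y)\<^sup>2)"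
      using c by (intro mult_left_mono) auto
    then show ?thesis by (simp add: left_diff_distrib right_diff_distrib mult_ac)
  qed
  have "(c * spow (q - 1) p - c * spow (q - 1) y) * (p - y) \<le> 16 * (K * (\<theta> * (b - y)\<^sup>2)) + 4 * (K * T * u\<^sup>2)"
  proof (cases "m / 2 \<le> M")
    case True
    \<comment> \<open>For \<open>2 \<le> q\<close> the power is increasing; otherwise halving the
      base costs \<open>2 powr (2 - q)\<close>, which is at most 2 because
      \<open>1 < q\<close>.\<close>
    have "M powr (q - 2) \<le> 2 * m powr (q - 2)"
    proof (cases "2 \<le> q")
      case True
      then have "M powr (q - 2) \<le> m powr (q - 2)" using M by (intro powr_mono2) auto
      moreover have "0 \<le> m powr (q - 2)" by simp
      ultimately show ?thesis by linarith
    next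
      case False
      have "M powr (q - 2) \<le> (m / 2) powr (q - 2)"
        using False True m0 by (intro powr_mono2') auto
      also have "\<dots> = 2 powr (2 - q) * m powr (q - 2)"
        using m0 powr_minus_divide[of 2 "q - 2"] by (simp add: powr_divide)
      also have "\<dots> \<le> 2 powr 1 * m powr (q - 2)"
        using q by (intro mult_right_mono powr_mono) auto
      finally show ?thesis by simp
    qed
    then have "c * M powr (q - 2) \<le> 2 * \<theta>"
      using mult_left_mono[of "M powr (q - 2)" _ c] c by (simp add: \<theta>_def mult_ac)
    then have 1: "K * (c * M powr (q - 2)) \<le> K * (2 * \<theta>)"
      using K by (intro mult_left_mono) auto
    have "\<bar>p - y\<bar> \<le> \<bar>(b - y) - u\<bar>"
      using shrink_diff(1)[OF r c, of p y] p by (simp add: u_def algebra_simps)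
    then have "(p - y)\<^sup>2 \<le> ((b - y) - u)\<^sup>2" by (metis abs_le_square_iff)
    also have "\<dots> \<le> 2 * (b - y)\<^sup>2 + 2 * u\<^sup>2" by (rule sq_diff_le)
    finally have 2: "(p - y)\<^sup>2 \<le> 2 * (b - y)\<^sup>2 + 2 * u\<^sup>2" .
    have "(c * spow (q - 1) p - c * spow (q - 1) y) * (p - y) \<le> K * (2 * \<theta>) * (2 * (b - y)\<^sup>2 + 2 * u\<^sup>2)"
      using order.trans[OF f mult_mono[OF 1 2]] K \<theta> by simp
    also have "\<dots> = 4 * (K * (\<theta> * (b - y)\<^sup>2)) + 4 * (K * \<theta> * u\<^sup>2)"
      by (simp add: algebra_simps)
    also have "\<dots> \<le> 16 * (K * (\<theta> * (b - y)\<^sup>2)) + 4 * (K * T * u\<^sup>2)"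
    proof -
      have "K * \<theta> * u\<^sup>2 \<le> K * T * u\<^sup>2"
        using K \<theta> by (intro mult_right_mono mult_left_mono) auto
      then show ?thesis using T0(2) by linarith
    qed
    finally show ?thesis .
  next
    case False
    \<comment> \<open>Since \<open>\<bar>y\<bar> \<le> M < m / 2\<close>, the maximum
      \<open>m\<close> is attained by \<open>\<bar>b\<bar>\<close>, which leaves at least
      \<open>m / 2\<close> for \<open>\<bar>b - y\<bar>\<close>.\<close>
    then have "2 * \<bar>y\<bar> < m" using M(4) by linarith
    moreover from this have "m = \<bar>b\<bar>" by (simp add: m_def max_def split: if_splits)
    ultimately have "m \<le> 2 * (\<bar>b\<bar> - \<bar>y\<bar>)" by simp
    also have "\<dots> \<le> 2 * \<bar>b - y\<bar>" by (intro mult_left_mono abs_triangle_ineq2) simp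
    finally have "m \<le> 2 * \<bar>b - y\<bar>" .
    then have "m\<^sup>2 \<le> (2 * \<bar>b - y\<bar>)\<^sup>2" using m0 by (intro power_mono) auto
    then have md: "m\<^sup>2 \<le> 4 * (b - y)\<^sup>2" by (simp add: power_mult_distrib)
    have sq: "t powr (q - 2) * t\<^sup>2 = t powr q" if "0 \<le> t" for t :: real
      using that powr_add[of t "q - 2" 2] by simp
    \<comment> \<open>Absorbing \<open>(p - y)\<^sup>2\<close> turns \<open>M powr (q - 2)\<close>,
      decreasing in \<open>M\<close> for \<open>q < 2\<close>, into \<open>M powr q\<close>, which
      is increasing, so that \<open>M\<close> can be replaced by \<open>m\<close>.\<close>
    have "\<bar>p - y\<bar> \<le> \<bar>2 * M\<bar>" using M by linarith
    then have "(p - y)\<^sup>2 \<le> (2 * M)\<^sup>2" by (metis abs_le_square_iff)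
    then have "(p - y)\<^sup>2 \<le> 4 * M\<^sup>2" by (simp add: power_mult_distrib)
    then have "K * (c * M powr (q - 2)) * (p - y)\<^sup>2 \<le> K * (c * M powr (q - 2)) * (4 * M\<^sup>2)"
      using K c by (intro mult_left_mono) auto
    also have "\<dots> = 4 * (K * c * M powr q)"
      unfolding sq[OF M(1), symmetric] by (simp add: mult_ac)
    also have "\<dots> \<le> 4 * (K * c * m powr q)"
      using K c q M by (intro mult_left_mono powr_mono2) auto
    also have "\<dots> = 4 * (K * (\<theta> * m\<^sup>2))"
      using m0 unfolding sq[OF less_imp_le[OF m0], symmetric] by (simp add: \<theta>_def mult_ac)
    also have "\<dots> \<le> 4 * (K * (\<theta> * (4 * (b - y)\<^sup>2)))"
      using K \<theta> md by (intro mult_left_mono) auto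
    finally have "K * (c * M powr (q - 2)) * (p - y)\<^sup>2 \<le> 16 * (K * (\<theta> * (b - y)\<^sup>2))" by simp
    then show ?thesis using f T0(1) by linarith
  qed
  then show ?thesis by (simp add: K_def \<theta>_def m_def u_def mult.assoc)
qed

text \<open>The hypothesis says that \<theta> exceeds \<open>1 / C\<close> for nonzero data. If
  \<open>\<bar>y\<bar> \<le> \<bar>b\<bar>\<close>, then
  \<open>1 + K * \<theta> \<le> (C + K) * \<theta>\<close>, so \<open>\<theta> ^ 3\<close> cancels
  in the cubic lower bound and \<open>b\<^sup>2\<close> is controlled. Otherwise multiplying the
  hypothesis by \<open>\<bar>y\<bar> powr (q - 1)\<close> bounds \<open>\<bar>y\<bar>\<close> by
  \<open>C\<close> times the source term.\<close>

lemma noise_small: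
  fixes b p p2 y c q C :: real
  assumes q: "1 < q" and c: "0 < c" and C: "0 < C"
    and p: "p + c * spow (q - 1) p = b" and p2: "p2 + c * spow (q - 1) p2 = 2 * b - p"
    and small: "max \<bar>y\<bar> \<bar>b\<bar> powr (2 - q) < C * c"
  shows "(b - y)\<^sup>2 \<le> 4 * (C + max 2 (q - 1)) ^ 3 / min (q - 1) 1 * ((b - p) * (b - p2))
    + 4 * C\<^sup>2 * (c * spow (q - 1) y)\<^sup>2"
proof -
  define K where "K = max 2 (q - 1)"
  define k where "k = min (q - 1) 1"
  define g where "g = (b - p) * (b - p2)"
  have r: "0 < q - 1" using q by simp
  have K: "0 < K" and k: "0 < k" using q by (auto simp: K_def k_def)
  have g: "0 \<le> g" unfolding g_def by (rule hanke_raus_term_bounds(1)[OF r c p p2])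
  have nonneg: "0 \<le> 4 * (C + K) ^ 3 / k * g" "0 \<le> 4 * C\<^sup>2 * (c * spow (q - 1) y)\<^sup>2"
    using K k g C by auto
  have "(b - y)\<^sup>2 \<le> 4 * (C + K) ^ 3 / k * g + 4 * C\<^sup>2 * (c * spow (q - 1) y)\<^sup>2"
  \<comment> \<open>With both entries zero, \<open>0 powr (q - 2)\<close> defaults to 0 and \<theta>
    is no longer large; the left side vanishes then.\<close>
  proof (cases "b = 0 \<and> y = 0")
    case True
    then show ?thesis using nonneg by simp
  next
    case nz: False
    show ?thesis
    proof (cases "\<bar>y\<bar> \<le> \<bar>b\<bar>")
      case True
      then have b: "0 < \<bar>b\<bar>" using nz by auto
      define \<theta> where "\<theta> = c * \<bar>b\<bar> powr (q - 1 - 1)"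
      have "\<theta> = c / \<bar>b\<bar> powr (2 - q)"
        using powr_minus_divide[of "\<bar>b\<bar>" "2 - q"] by (simp add: \<theta>_def)
      moreover have "\<bar>b\<bar> powr (2 - q) < C * c" using small True by (simp add: max_absorb2)
      ultimately have C\<theta>: "1 < C * \<theta>" using b by (simp add: less_divide_eq)
      then have \<theta>: "0 < \<theta>" using b c by (simp add: \<theta>_def)
      have "k * \<theta> ^ 3 * b\<^sup>2 \<le> g * (1 + K * \<theta>) ^ 3"
        unfolding k_def K_def g_def \<theta>_def by (rule hanke_raus_term_bounds(3)[OF r c p p2])
      also have "\<dots> \<le> g * ((C + K) * \<theta>) ^ 3"
        using C\<theta> K \<theta> g by (intro mult_left_mono power_mono) (auto simp: algebra_simps)
      finally have "\<theta> ^ 3 * (k * b\<^sup>2) \<le> \<theta> ^ 3 * (g * (C + K) ^ 3)"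
        by (simp add: power_mult_distrib mult_ac)
      then have "k * b\<^sup>2 \<le> g * (C + K) ^ 3" using \<theta> by simp
      then have "4 * b\<^sup>2 \<le> 4 * (C + K) ^ 3 / k * g" using k by (simp add: field_simps)
      moreover have "\<bar>b - y\<bar> \<le> \<bar>2 * b\<bar>" using True by linarith
      then have "(b - y)\<^sup>2 \<le> (2 * b)\<^sup>2" by (metis abs_le_square_iff)
      then have "(b - y)\<^sup>2 \<le> 4 * b\<^sup>2" by (simp add: power_mult_distrib)
      ultimately show ?thesis using nonneg(2) by linarith
    next
      case False
      then have y: "0 < \<bar>y\<bar>" by linarith
      have "\<bar>y\<bar> powr (2 - q) < C * c" using small False by (simp add: max_absorb1)
      then have "\<bar>y\<bar> powr (2 - q) * \<bar>y\<bar> powr (q - 1) \<le> C * c * \<bar>y\<bar> powr (q - 1)"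
        by (intro mult_right_mono) auto
      moreover have "\<bar>y\<bar> powr (2 - q) * \<bar>y\<bar> powr (q - 1) = \<bar>y\<bar>"
        using y by (simp flip: powr_add)
      ultimately have "\<bar>y\<bar> \<le> \<bar>C * (c * spow (q - 1) y)\<bar>"
        using C c by (simp add: abs_mult abs_spow mult.assoc)
      then have "\<bar>b - y\<bar> \<le> \<bar>2 * (C * (c * spow (q - 1) y))\<bar>" using False by linarith
      then have "(b - y)\<^sup>2 \<le> (2 * (C * (c * spow (q - 1) y)))\<^sup>2" by (metis abs_le_square_iff)
      also have "\<dots> = 4 * C\<^sup>2 * (c * spow (q - 1) y)\<^sup>2"
        by (simp add: power_mult_distrib)
      finally show ?thesis using nonneg by linarith
    qed
  qed
  then show ?thesis by (simp add: K_def k_def g_def)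
qed

section \<open>Diagonal operators and their minimisers\<close>

lemma lq_2_iff: "x \<in> lq 2 \<longleftrightarrow> summable (\<lambda>n. (x n)\<^sup>2)"
  by (simp add: lq_def)

lemma lq_norm_powr:
  assumes "0 < q" "x \<in> lq q"
  shows "lq_norm q x powr q = (\<Sum>n. \<bar>x n\<bar> powr q)"
proof -
  have "0 \<le> (\<Sum>n. \<bar>x n\<bar> powr q)"
    using assms by (intro suminf_nonneg) (auto simp: lq_def)
  then show ?thesis using assms by (simp add: lq_norm_def powr_powr)
qed

lemma lq_norm_nonneg: "0 \<le> lq_norm q x"
  by (simp add: lq_norm_def)

lemma lq_norm_2_sq:
  assumes "x \<in> lq 2"
  shows "(lq_norm 2 x)\<^sup>2 = (\<Sum>n. (x n)\<^sup>2)"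
  using lq_norm_powr[of 2 x] assms lq_norm_nonneg[of 2 x] by simp

lemma reg_eq:
  assumes "0 < q" "x \<in> lq q"
  shows "reg q x = (\<Sum>n. \<bar>x n\<bar> powr q) / q"
  using lq_norm_powr[OF assms] by (simp add: reg_def)

lemma abs_le_lq_norm_2:
  assumes "x \<in> lq 2"
  shows "\<bar>x n\<bar> \<le> lq_norm 2 x"
proof (rule power2_le_imp_le)
  have "sum (\<lambda>n. (x n)\<^sup>2) {n} \<le> (\<Sum>n. (x n)\<^sup>2)"
    using assms by (intro sum_le_suminf) (auto simp: lq_2_iff)
  then show "\<bar>x n\<bar>\<^sup>2 \<le> (lq_norm 2 x)\<^sup>2"
    by (simp add: lq_norm_2_sq[OF assms])
qed (rule lq_norm_nonneg)

lemma lq_add: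
  assumes q: "0 < q" and "x \<in> lq q" "z \<in> lq q"
  shows "(\<lambda>n. x n + z n) \<in> lq q"
proof -
  have le: "\<bar>a + b\<bar> powr q \<le> 2 powr q * \<bar>a\<bar> powr q + 2 powr q * \<bar>b\<bar> powr q" for a b :: real
  proof -
    have "\<bar>a + b\<bar> powr q \<le> (2 * max \<bar>a\<bar> \<bar>b\<bar>) powr q"
      using q by (intro powr_mono2) auto
    also have "\<dots> = 2 powr q * max \<bar>a\<bar> \<bar>b\<bar> powr q" by (simp add: powr_mult)
    also have "\<dots> \<le> 2 powr q * (\<bar>a\<bar> powr q + \<bar>b\<bar> powr q)"
      by (intro mult_left_mono) (auto simp: max_def)
    finally show ?thesis by (simp add: algebra_simps)
  qed
  have "summable (\<lambda>n. 2 powr q * \<bar>x n\<bar> powr q + 2 powr q * \<bar>z n\<bar> powr q)"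
    using assms by (auto simp: lq_def intro!: summable_add summable_mult)
  then show ?thesis
    unfolding lq_def mem_Collect_eq
    by (rule summable_comparison_test_ev[rotated]) (use le in auto)
qed

lemma lq_scale:
  assumes "x \<in> lq q"
  shows "(\<lambda>n. c * x n) \<in> lq q"
  using assms summable_mult[of "\<lambda>n. \<bar>x n\<bar> powr q" "\<bar>c\<bar> powr q"]
  by (simp add: lq_def abs_mult powr_mult)

lemma lq_diff:
  assumes "0 < q" "x \<in> lq q" "z \<in> lq q"
  shows "x - z \<in> lq q"
  using lq_add[OF assms(1,2) lq_scale[OF assms(3), of "-1"]] by (simp add: fun_diff_def)

lemma lq_finite_support:
  assumes "finite I" "\<And>n. n \<notin> I \<Longrightarrow> x n = 0"
  shows "x \<in> lq q"
  using summable_finite[OF assms(1), of "\<lambda>n. \<bar>x n\<bar> powr q"] assms(2) by (simp add: lq_def)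

lemma summable_mult_lq_2:
  assumes "u \<in> lq 2" "v \<in> lq 2"
  shows "summable (\<lambda>n. u n * v n)"
proof -
  have "summable (\<lambda>n. (u n)\<^sup>2 + (v n)\<^sup>2)"
    using assms by (intro summable_add) (simp_all add: lq_2_iff)
  moreover have "norm (u n * v n) \<le> (u n)\<^sup>2 + (v n)\<^sup>2" for n
  proof -
    have "2 * (\<bar>u n\<bar> * \<bar>v n\<bar>) \<le> (u n)\<^sup>2 + (v n)\<^sup>2"
      using sum_squares_bound[of "\<bar>u n\<bar>" "\<bar>v n\<bar>"] by (simp add: mult.assoc)
    moreover have "0 \<le> \<bar>u n\<bar> * \<bar>v n\<bar>" by simp
    ultimately show ?thesis unfolding real_norm_def abs_mult by linarith
  qed
  ultimately show ?thesis
    using summable_comparison_test'[of "\<lambda>n. (u n)\<^sup>2 + (v n)\<^sup>2" 0 "\<lambda>n. u n * v n"] by blast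
qed

text \<open>Translates the unordered sums of the noise condition into the sequential sums of the
  error estimates; nonnegativity makes both agree.\<close>

lemma infsum_eq_suminf_if:
  fixes f :: "nat \<Rightarrow> real"
  assumes "summable (\<lambda>n. if n \<in> S then f n else 0)" "\<And>n. n \<in> S \<Longrightarrow> 0 \<le> f n"
  shows "infsum f S = (\<Sum>n. if n \<in> S then f n else 0)"
proof -
  let ?g = "\<lambda>n. if n \<in> S then f n else 0"
  have "?g summable_on UNIV"
    using assms by (intro summable_nonneg_imp_summable_on) auto
  then have "infsum ?g UNIV = suminf ?g"
    using has_sum_imp_sums has_sum_infsum sums_unique by blast
  moreover have "infsum f S = infsum ?g UNIV" by (rule infsum_cong_neutral) auto
  ultimately show ?thesis by simp
qed

lemma summable_if:
  fixes f :: "nat \<Rightarrow> real"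
  assumes "summable f" "\<And>n. 0 \<le> f n"
  shows "summable (\<lambda>n. if n \<in> S then f n else 0)"
  using summable_comparison_test'[of f 0 "\<lambda>n. if n \<in> S then f n else 0"] assms by auto

section \<open>Coordinate formula for the diagonal operator\<close>

locale diagonal_operator =
  fixes q :: real and lam :: "nat \<Rightarrow> real" and A :: "(nat \<Rightarrow> real) \<Rightarrow> nat \<Rightarrow> real"
  assumes q1: "1 < q"
    and lam_pos: "0 < lam n"
    and bdd: "bounded_operator q 2 A"
    and A_unit: "A (unit_seq n) = (\<lambda>k. lam n * unit_seq n k)"
begin

lemma A_mem: "x \<in> lq q \<Longrightarrow> A x \<in> lq 2"
  using bdd by (simp add: bounded_operator_def)

lemma A_add: "x \<in> lq q \<Longrightarrow> z \<in> lq q \<Longrightarrow> A (\<lambda>n. x n + z n) = (\<lambda>n. A x n + A z n)"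
  and A_scale: "x \<in> lq q \<Longrightarrow> A (\<lambda>n. c * x n) = (\<lambda>n. c * A x n)"
  using bdd by (simp_all add: bounded_operator_def)

lemma A_truncation: "A (\<lambda>k. if k < N then x k else 0) = (\<lambda>k. if k < N then lam k * x k else 0)"
proof (induction N)
  case 0
  have zero: "(\<lambda>n. 0) \<in> lq q" by (simp add: lq_def)
  show ?case using A_scale[OF zero, of 0] by simp
next
  case (Suc N)
  let ?t = "\<lambda>k. if k < N then x k else 0"
  have t: "?t \<in> lq q" by (rule lq_finite_support[of "{..<N}"]) auto
  have e: "unit_seq N \<in> lq q" by (rule lq_finite_support[of "{N}"]) (auto simp: unit_seq_def)
  have "(\<lambda>k. if k < Suc N then x k else 0) = (\<lambda>k. ?t k + x N * unit_seq N k)"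
    by (auto simp: fun_eq_iff unit_seq_def less_Suc_eq)
  then have "A (\<lambda>k. if k < Suc N then x k else 0) = A (\<lambda>k. ?t k + x N * unit_seq N k)"
    by simp
  also have "\<dots> = (\<lambda>k. A ?t k + A (\<lambda>k. x N * unit_seq N k) k)"
    by (rule A_add[OF t lq_scale[OF e]])
  also have "A (\<lambda>k. x N * unit_seq N k) = (\<lambda>k. x N * A (unit_seq N) k)"
    by (rule A_scale[OF e])
  finally show ?case
    unfolding Suc A_unit by (auto simp: fun_eq_iff unit_seq_def less_Suc_eq)
qed

text \<open>Linearity determines \<open>A\<close> on truncations only. Boundedness handles the
  remaining tail, whose norm tends to 0 because the series defining the norm converges.\<close>

lemma A_apply:
  assumes x: "x \<in> lq q"
  shows "A x n = lam n * x n"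
proof -
  obtain K where K: "\<And>z. z \<in> lq q \<Longrightarrow> lq_norm 2 (A z) \<le> K * lq_norm q z"
    using bdd unfolding bounded_operator_def by blast
  define f where "f = (\<lambda>k. \<bar>x k\<bar> powr q)"
  have f: "summable f" using x by (simp add: lq_def f_def)
  define tail where "tail N = (\<lambda>k. if k < N then 0 else x k)" for N
  have tail_sums: "(\<lambda>k. \<bar>tail N k\<bar> powr q) sums (suminf f - sum f {..<N})" for N
  proof -
    have "(\<lambda>k. f k - (if k \<in> {..<N} then f k else 0)) sums (suminf f - sum f {..<N})"
      by (intro sums_diff summable_sums f sums_If_finite_set) simp
    moreover have "(\<lambda>k. f k - (if k \<in> {..<N} then f k else 0)) = (\<lambda>k. \<bar>tail N k\<bar> powr q)"
      by (auto simp: fun_eq_iff tail_def f_def)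
    ultimately show ?thesis by simp
  qed
  have tail_mem: "tail N \<in> lq q" for N
    using tail_sums sums_summable unfolding lq_def by blast
  have tail_norm: "lq_norm q (tail N) = (suminf f - sum f {..<N}) powr (1 / q)" for N
    unfolding lq_norm_def using sums_unique[OF tail_sums[of N]] by simp
  have "(\<lambda>N. suminf f - sum f {..<N}) \<longlonglongrightarrow> suminf f - suminf f"
    by (intro tendsto_intros summable_LIMSEQ f)
  moreover have "0 \<le> suminf f - sum f {..<N}" for N
    using sum_le_suminf[OF f, of "{..<N}"] by (simp add: f_def)
  ultimately have "(\<lambda>N. lq_norm q (tail N)) \<longlonglongrightarrow> 0"
    unfolding tail_norm using q1 tendsto_powr'[OF _ tendsto_const, of _ 0 sequentially "1 / q"]
    by simp
  then have lim: "(\<lambda>N. K * lq_norm q (tail N)) \<longlonglongrightarrow> 0"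
    using tendsto_mult_right_zero by blast
  have "\<bar>A x n - lam n * x n\<bar> \<le> K * lq_norm q (tail N)" if "N \<ge> Suc n" for N
  proof -
    have t: "(\<lambda>k. if k < N then x k else 0) \<in> lq q" by (rule lq_finite_support[of "{..<N}"]) auto
    have "x = (\<lambda>k. (if k < N then x k else 0) + tail N k)"
      by (auto simp: fun_eq_iff tail_def)
    then have "A x = A (\<lambda>k. (if k < N then x k else 0) + tail N k)" by simp
    also have "\<dots> = (\<lambda>k. A (\<lambda>k. if k < N then x k else 0) k + A (tail N) k)"
      by (rule A_add[OF t tail_mem])
    finally have "A x n - lam n * x n = A (tail N) n"
      using that by (simp add: A_truncation)
    also have "\<bar>\<dots>\<bar> \<le> lq_norm 2 (A (tail N))"
      by (intro abs_le_lq_norm_2 A_mem tail_mem)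
    also have "\<dots> \<le> K * lq_norm q (tail N)" by (intro K tail_mem)
    finally show ?thesis .
  qed
  then have "\<bar>A x n - lam n * x n\<bar> \<le> 0"
    by (intro tendsto_lowerbound[OF lim]) (auto simp: eventually_sequentially)
  then show ?thesis by simp
qed

section \<open>Optimality conditions for the two minimisation problems\<close>

text \<open>
  The Tikhonov functional and the functional of the second Bregman step are both of this form;
  with \<open>p n = lam n * x n\<close> the optimality condition decouples into scalar equations.
\<close>

lemma arg_min_on_lq:
  fixes F :: "(nat \<Rightarrow> real) \<Rightarrow> real"
  assumes \<alpha>: "0 < \<alpha>" and b: "b \<in> lq 2" and v: "v \<in> lq 2"
    and F: "\<And>z. z \<in> lq q \<Longrightarrow>
      F z = 1 / 2 * (lq_norm 2 (A z - b))\<^sup>2 + \<alpha> * reg q z - (\<Sum>n. v n * A z n) + C"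
  shows "arg_min_on F (lq q) \<in> lq q"
    and "lam n * arg_min_on F (lq q) n
      + \<alpha> / lam n powr q * spow (q - 1) (lam n * arg_min_on F (lq q) n) = b n + v n"
proof -
  have bv: "(\<lambda>n. b n + v n) \<in> lq 2" by (intro lq_add b v) simp
  have "\<exists>p. \<forall>n. p n + \<alpha> / lam n powr q * spow (q - 1) (p n) = b n + v n"
    by (intro choice allI ex_shrink divide_pos_pos \<alpha>) (use q1 less_imp_neq[OF lam_pos] in auto)
  then obtain p where p: "\<And>n. p n + \<alpha> / lam n powr q * spow (q - 1) (p n) = b n + v n"
    by blast
  define x where "x n = p n / lam n" for n
  have lx: "lam n * x n = p n" for n using lam_pos[of n] by (simp add: x_def)
  have x: "x \<in> lq q"
  proof -
    \<comment> \<open>Up to the factor \<alpha> the summand is the product of \<open>p n\<close> and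
      its penalty term, both bounded by \<open>\<bar>b n + v n\<bar>\<close>; the square of the
      latter is summable.\<close>
    have le: "norm (\<bar>x n\<bar> powr q) \<le> 1 / \<alpha> * (b n + v n)\<^sup>2" for n
    proof -
      have c: "0 < \<alpha> / lam n powr q" using \<alpha> lam_pos[of n] by simp
      have "\<bar>x n\<bar> powr q = \<bar>p n\<bar> powr q / lam n powr q"
        using lam_pos[of n] by (simp add: x_def powr_divide)
      then have "\<alpha> * \<bar>x n\<bar> powr q = \<bar>p n * (\<alpha> / lam n powr q * spow (q - 1) (p n))\<bar>"
        using mult_spow[of "p n" "q - 1"] c
        by (simp add: mult.left_commute[of "p n"] abs_mult \<alpha> less_imp_le)
      also have "\<dots> \<le> \<bar>b n + v n\<bar> * \<bar>b n + v n\<bar>"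
        unfolding abs_mult[of "p n"]
        using shrink_abs_le[OF _ c p] q1 by (intro mult_mono) auto
      finally show ?thesis using \<alpha> by (simp add: field_simps power2_eq_square)
    qed
    have "summable (\<lambda>n. 1 / \<alpha> * (b n + v n)\<^sup>2)"
      using bv by (intro summable_mult) (simp add: lq_2_iff)
    then show ?thesis
      unfolding lq_def mem_Collect_eq
      using summable_comparison_test'[of "\<lambda>n. 1 / \<alpha> * (b n + v n)\<^sup>2" 0 "\<lambda>n. \<bar>x n\<bar> powr q"] le by blast
  qed
  have foc: "lam n * (lam n * x n - b n - v n) = - \<alpha> * spow (q - 1) (x n)" for n
  proof -
    have "p n - b n - v n = - (\<alpha> / lam n powr q * spow (q - 1) (lam n * x n))"
      using p[of n] lx[of n] by simp
    also have "\<dots> = - (\<alpha> / lam n * spow (q - 1) (x n))"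
      using lam_pos[of n] by (simp add: spow_mult_pos powr_diff)
    finally show ?thesis using lam_pos[of n] lx[of n] by simp
  qed
  \<comment> \<open>The coordinate contributions to \<open>F z - C\<close>.\<close>
  define g where "g z n = (1 / 2 * (A z n - b n)\<^sup>2 + \<alpha> * (\<bar>z n\<bar> powr q / q)) - v n * A z n" for z n
  have g_sums: "g z sums (F z - C)" if z: "z \<in> lq q" for z
  proof -
    have *: "A z - b \<in> lq 2" using z by (intro lq_diff A_mem b) auto
    then have "(\<lambda>n. (A z n - b n)\<^sup>2) sums (lq_norm 2 (A z - b))\<^sup>2"
      using lq_norm_2_sq[OF *] by (simp add: lq_2_iff summable_sums)
    moreover have "(\<lambda>n. \<bar>z n\<bar> powr q) sums (\<Sum>n. \<bar>z n\<bar> powr q)"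
      using z by (simp add: lq_def summable_sums)
    then have "(\<lambda>n. \<bar>z n\<bar> powr q / q) sums reg q z"
      using z q1 by (simp add: reg_eq sums_divide)
    moreover have "(\<lambda>n. v n * A z n) sums (\<Sum>n. v n * A z n)"
      by (intro summable_sums summable_mult_lq_2 v A_mem z)
    ultimately show ?thesis
      unfolding g_def F[OF z] add_diff_cancel_right' by (intro sums_diff sums_add sums_mult)
  qed
  \<comment> \<open>The quadratic part is expanded exactly at \<open>x n\<close>. By
    \<open>foc\<close> its linear term cancels the tangent of the penalty, so a half square
    survives; this yields both minimality and uniqueness.\<close>
  have gap: "1 / 2 * (lam n * (z n - x n))\<^sup>2 \<le> g z n - g x n" if z: "z \<in> lq q" for z n
  proof -
    have "\<alpha> * (\<bar>x n\<bar> powr q / q + spow (q - 1) (x n) * (z n - x n)) \<le> \<alpha> * (\<bar>z n\<bar> powr q / q)"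
      using powr_tangent_le[OF q1] \<alpha> by (intro mult_left_mono) auto
    then have "\<alpha> * (\<bar>x n\<bar> powr q / q) + \<alpha> * spow (q - 1) (x n) * (z n - x n)
        \<le> \<alpha> * (\<bar>z n\<bar> powr q / q)"
      by (simp add: distrib_left mult.assoc)
    moreover have "\<alpha> * spow (q - 1) (x n) = - (lam n * (lam n * x n - b n - v n))"
      using foc[of n] by simp
    ultimately have *: "\<alpha> * (\<bar>x n\<bar> powr q / q) - (lam n * (lam n * x n - b n - v n)) * (z n - x n)
        \<le> \<alpha> * (\<bar>z n\<bar> powr q / q)" by simp
    have "1 / 2 * (lam n * z n - b n)\<^sup>2 - v n * (lam n * z n)
        - (1 / 2 * (lam n * x n - b n)\<^sup>2 - v n * (lam n * x n))
      = lam n * (lam n * x n - b n - v n) * (z n - x n) + 1 / 2 * (lam n * (z n - x n))\<^sup>2"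
      by (simp add: power2_eq_square field_simps)
    then show ?thesis using * unfolding g_def A_apply[OF z] A_apply[OF x] by linarith
  qed
  have gap_sums: "(\<lambda>n. g z n - g x n) sums (F z - F x)" if "z \<in> lq q" for z
    using sums_diff[OF g_sums[OF that] g_sums[OF x]] by simp
  have gap_nonneg: "0 \<le> g z n - g x n" if "z \<in> lq q" for z n
    using gap[OF that, of n] zero_le_power2[of "lam n * (z n - x n)"] by linarith
  have min: "F x \<le> F z" if "z \<in> lq q" for z
    using sums_le[OF gap_nonneg[OF that] sums_zero gap_sums[OF that]] by simp
  have uniq: "z = x" if z: "z \<in> lq q" "F z \<le> F x" for z
  proof
    fix n
    have "F z - F x = 0" using min[OF z(1)] z(2) by simp
    then have "g z n - g x n = 0"
      using suminf_eq_zero_iff[OF sums_summable[OF gap_sums[OF z(1)]] gap_nonneg[OF z(1)]]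
        sums_unique[OF gap_sums[OF z(1)]] by simp
    then have "(lam n * (z n - x n))\<^sup>2 \<le> 0" using gap[OF z(1), of n] by simp
    then show "z n = x n" using lam_pos[of n] by simp
  qed
  \<comment> \<open>\<open>arg_min_on\<close> is a choice among minimisers, so its value is
    identified through uniqueness.\<close>
  have "is_arg_min F (\<lambda>x. x \<in> lq q) x"
    using x min by (auto simp: is_arg_min_def not_less)
  moreover have "z = x" if "is_arg_min F (\<lambda>x. x \<in> lq q) z" for z
    using that x by (intro uniq) (auto simp: is_arg_min_def not_less)
  ultimately have "arg_min_on F (lq q) = x"
    unfolding arg_min_on_def arg_min_def by (rule some_equality)
  then show "arg_min_on F (lq q) \<in> lq q"
    "lam n * arg_min_on F (lq q) n
      + \<alpha> / lam n powr q * spow (q - 1) (lam n * arg_min_on F (lq q) n) = b n + v n"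
    using x p[of n] lx[of n] by simp_all
qed

lemma tikhonov:
  assumes \<alpha>: "0 < \<alpha>" and b: "b \<in> lq 2"
  shows "tikhonov A q b \<alpha> \<in> lq q"
    and "lam n * tikhonov A q b \<alpha> n
      + \<alpha> / lam n powr q * spow (q - 1) (lam n * tikhonov A q b \<alpha> n) = b n"
proof -
  have v: "(\<lambda>_. 0) \<in> lq 2" by (simp add: lq_def)
  show "tikhonov A q b \<alpha> \<in> lq q"
    unfolding tikhonov_def by (rule arg_min_on_lq(1)[OF \<alpha> b v, where C = 0]) simp
  show "lam n * tikhonov A q b \<alpha> n
      + \<alpha> / lam n powr q * spow (q - 1) (lam n * tikhonov A q b \<alpha> n) = b n"
    unfolding tikhonov_def
    by (subst arg_min_on_lq(2)[OF \<alpha> b v, where C = 0]) simp_all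
qed

text \<open>The linear part of the Bregman distance contributes, up to a constant, the pairing of
  \<open>A z\<close> with the Tikhonov residual \<open>v = b - A x\<close>. The second step is thus
  a Tikhonov problem with data \<open>b + v\<close>.\<close>

lemma bregman_iterate2:
  assumes \<alpha>: "0 < \<alpha>" and b: "b \<in> lq 2"
  shows "bregman_iterate2 A q b \<alpha> \<in> lq q"
    and "lam n * bregman_iterate2 A q b \<alpha> n
      + \<alpha> / lam n powr q * spow (q - 1) (lam n * bregman_iterate2 A q b \<alpha> n)
      = 2 * b n - lam n * tikhonov A q b \<alpha> n"
proof -
  define x where "x = tikhonov A q b \<alpha>"
  define v where "v = b - A x"
  have x: "x \<in> lq q" unfolding x_def by (rule tikhonov[OF \<alpha> b])
  have v: "v \<in> lq 2" unfolding v_def by (intro lq_diff b A_mem x) simp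
  have F: "1 / 2 * (lq_norm 2 (A z - b))\<^sup>2 + \<alpha> * bregman q (tikhonov_subgrad A q b \<alpha>) z x
      = 1 / 2 * (lq_norm 2 (A z - b))\<^sup>2 + \<alpha> * reg q z - (\<Sum>n. v n * A z n)
        + ((\<Sum>n. v n * A x n) - \<alpha> * reg q x)" if z: "z \<in> lq q" for z
  proof -
    have zx: "z - x \<in> lq q" using q1 by (intro lq_diff z x) simp
    have "l2_inner (A x - b) (A (z - x)) = (\<Sum>n. v n * A x n - v n * A z n)"
      unfolding l2_inner_def v_def
      by (simp add: A_apply[OF zx] A_apply[OF x] A_apply[OF z] algebra_simps)
    also have "\<dots> = (\<Sum>n. v n * A x n) - (\<Sum>n. v n * A z n)"
      by (intro suminf_diff[symmetric] summable_mult_lq_2 v A_mem x z)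
    finally show ?thesis
      using \<alpha> unfolding bregman_def tikhonov_subgrad_def dual_adjoint_def x_def[symmetric]
      by (simp add: algebra_simps)
  qed
  show "bregman_iterate2 A q b \<alpha> \<in> lq q"
    unfolding bregman_iterate2_def x_def[symmetric] by (rule arg_min_on_lq(1)[OF \<alpha> b v F])
  show "lam n * bregman_iterate2 A q b \<alpha> n
      + \<alpha> / lam n powr q * spow (q - 1) (lam n * bregman_iterate2 A q b \<alpha> n)
      = 2 * b n - lam n * tikhonov A q b \<alpha> n"
    unfolding bregman_iterate2_def x_def[symmetric]
    by (subst arg_min_on_lq(2)[OF \<alpha> b v F]) (simp_all add: v_def A_apply[OF x])
qed

text \<open>Testing the subgradient inequality with multiples of \<open>unit_seq n\<close> changes
  one coordinate only and leaves the hypothesis of \<open>tangent_unique\<close>.\<close>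

lemma subdiff_adjoint:
  assumes x: "x \<in> lq q" and w: "w \<in> lq 2" and sub: "dual_adjoint A w \<in> subdiff q x"
  shows "lam n * w n = spow (q - 1) (x n)"
proof (rule tangent_unique[OF q1])
  fix t :: real
  define z where "z = (\<lambda>k. x k + t * unit_seq n k)"
  have e: "unit_seq n \<in> lq q" by (rule lq_finite_support[of "{n}"]) (auto simp: unit_seq_def)
  have z: "z \<in> lq q" unfolding z_def using q1 by (intro lq_add x lq_scale e) simp
  have zx: "z - x \<in> lq q" using q1 by (intro lq_diff z x) simp
  have "l2_inner w (A (z - x)) = (\<Sum>k. if k = n then lam n * w n * t else 0)"
    unfolding l2_inner_def A_apply[OF zx] by (intro suminf_cong) (auto simp: z_def unit_seq_def)
  also have "\<dots> = lam n * w n * t"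
    using sums_unique[OF sums_single[of n "\<lambda>_. lam n * w n * t"]] by simp
  finally have pair: "l2_inner w (A (z - x)) = lam n * w n * t" .
  have sm: "summable (\<lambda>k. \<bar>x k\<bar> powr q)" "summable (\<lambda>k. \<bar>z k\<bar> powr q)"
    using x z by (auto simp: lq_def)
  have "(\<Sum>k. \<bar>z k\<bar> powr q) - (\<Sum>k. \<bar>x k\<bar> powr q) = (\<Sum>k. \<bar>z k\<bar> powr q - \<bar>x k\<bar> powr q)"
    by (rule suminf_diff[OF sm(2,1)])
  also have "\<dots> = (\<Sum>k. if k = n then \<bar>x n + t\<bar> powr q - \<bar>x n\<bar> powr q else 0)"
    by (intro suminf_cong) (auto simp: z_def unit_seq_def)
  also have "\<dots> = \<bar>x n + t\<bar> powr q - \<bar>x n\<bar> powr q"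
    using sums_unique[OF sums_single[of n "\<lambda>_. \<bar>x n + t\<bar> powr q - \<bar>x n\<bar> powr q"]] by simp
  finally have diff: "(\<Sum>k. \<bar>z k\<bar> powr q) - (\<Sum>k. \<bar>x k\<bar> powr q) = \<bar>x n + t\<bar> powr q - \<bar>x n\<bar> powr q" .
  have "reg q x + dual_adjoint A w (z - x) \<le> reg q z"
    using sub z by (simp add: subdiff_def)
  then have "lam n * w n * t \<le> ((\<Sum>k. \<bar>z k\<bar> powr q) - (\<Sum>k. \<bar>x k\<bar> powr q)) / q"
    using q1 by (simp add: reg_eq x z dual_adjoint_def pair diff_divide_distrib)
  then show "\<bar>x n\<bar> powr q / q + lam n * w n * t \<le> \<bar>x n + t\<bar> powr q / q"
    unfolding diff by (simp add: diff_divide_distrib)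
qed

subsection \<open>Error estimates\<close>

lemma hanke_raus_sums:
  assumes \<alpha>: "0 < \<alpha>" and b: "b \<in> lq 2"
  shows "(\<lambda>n. (b n - lam n * tikhonov A q b \<alpha> n) * (b n - lam n * bregman_iterate2 A q b \<alpha> n))
    sums (\<alpha> * psi_HR A q b \<alpha>)"
proof -
  let ?x = "tikhonov A q b \<alpha>" and ?z = "bregman_iterate2 A q b \<alpha>"
  note x = tikhonov(1)[OF \<alpha> b] and z = bregman_iterate2(1)[OF \<alpha> b]
  have "b - A ?x \<in> lq 2" "b - A ?z \<in> lq 2"
    by (auto intro!: lq_diff b A_mem x z)
  then have "(\<lambda>n. (b - A ?z) n * (b - A ?x) n) sums l2_inner (b - A ?z) (b - A ?x)"
    unfolding l2_inner_def by (intro summable_sums summable_mult_lq_2)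
  then show ?thesis
    using \<alpha> by (simp add: psi_HR_def A_apply[OF x] A_apply[OF z] mult.commute)
qed

text \<open>Each term is at most \<open>(b n - p)\<^sup>2\<close>, where
  \<open>b n - p = c * spow (q - 1) p\<close>. The complement of the proximal map is nonexpansive,
  and at \<open>y n\<close> its penalty term is \<open>\<alpha> * w n\<close>, so the residual is
  comparable to noise plus source.\<close>

lemma hanke_raus_upper:
  assumes \<alpha>: "0 < \<alpha>" and b: "b \<in> lq 2" and y: "y \<in> lq 2" and w: "w \<in> lq 2"
    and source: "\<And>n. spow (q - 1) (y n) = lam n powr q * w n"
  shows "\<alpha> * psi_HR A q b \<alpha> \<le> 2 * (lq_norm 2 (b - y))\<^sup>2 + 8 * \<alpha>\<^sup>2 * (lq_norm 2 w)\<^sup>2"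
proof -
  have by_mem: "b - y \<in> lq 2" by (intro lq_diff b y) simp
  have sums: "(\<lambda>n. 2 * (b n - y n)\<^sup>2 + 8 * \<alpha>\<^sup>2 * (w n)\<^sup>2)
      sums (2 * (lq_norm 2 (b - y))\<^sup>2 + 8 * \<alpha>\<^sup>2 * (lq_norm 2 w)\<^sup>2)"
    unfolding lq_norm_2_sq[OF by_mem] lq_norm_2_sq[OF w]
    using by_mem w by (intro sums_add sums_mult) (simp_all add: lq_2_iff summable_sums)
  show ?thesis
  proof (rule sums_le[OF _ hanke_raus_sums[OF \<alpha> b] sums])
    fix n
    define p where "p = lam n * tikhonov A q b \<alpha> n"
    define p2 where "p2 = lam n * bregman_iterate2 A q b \<alpha> n"
    define c where "c = \<alpha> / lam n powr q"
    have r: "0 < q - 1" using q1 by simp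
    have c: "0 < c" using \<alpha> less_imp_neq[OF lam_pos[of n]] by (simp add: c_def)
    have p: "p + c * spow (q - 1) p = b n"
      using tikhonov(2)[OF \<alpha> b] by (simp add: p_def c_def)
    have p2: "p2 + c * spow (q - 1) p2 = 2 * b n - p"
      using bregman_iterate2(2)[OF \<alpha> b] by (simp add: p_def p2_def c_def)
    have u: "c * spow (q - 1) (y n) = \<alpha> * w n"
      using lam_pos[of n] by (simp add: source c_def)
    have "\<bar>c * spow (q - 1) p - \<alpha> * w n\<bar> \<le> \<bar>(b n - y n) - \<alpha> * w n\<bar>"
      using shrink_diff(2)[OF r c, of p "y n"] p u by (simp add: algebra_simps)
    from sq_le_of_abs_diff_le[OF this] have "(b n - p)\<^sup>2 \<le> 2 * (b n - y n)\<^sup>2 + 8 * \<alpha>\<^sup>2 * (w n)\<^sup>2"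
      unfolding p[symmetric] by (simp add: power_mult_distrib)
    then show "(b n - p) * (b n - p2) \<le> 2 * (b n - y n)\<^sup>2 + 8 * \<alpha>\<^sup>2 * (w n)\<^sup>2"
      using hanke_raus_term_bounds(2)[OF r c p p2] by linarith
  qed
qed

text \<open>One nonnegative term bounds the whole series from below. Since \<theta> equals
  \<open>\<alpha> * \<tau> n\<close>, the cubic bound carries three powers of \<alpha>, one of which
  cancels against \<open>\<alpha> * psi_HR A q b \<alpha>\<close>.\<close>

lemma hanke_raus_lower:
  assumes \<alpha>: "0 < \<alpha>" and b: "b \<in> lq 2"
  defines "\<tau> \<equiv> \<lambda>n. \<bar>b n\<bar> powr (q - 2) / lam n powr q"
  shows "min (q - 1) 1 * \<alpha>\<^sup>2 * \<tau> n ^ 3 * (b n)\<^sup>2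
    \<le> psi_HR A q b \<alpha> * (1 + max 2 (q - 1) * \<alpha> * \<tau> n) ^ 3"
proof -
  define p where "p n = lam n * tikhonov A q b \<alpha> n" for n
  define p2 where "p2 n = lam n * bregman_iterate2 A q b \<alpha> n" for n
  define c where "c n = \<alpha> / lam n powr q" for n
  have r: "0 < q - 1" using q1 by simp
  have c: "0 < c n" for n using \<alpha> less_imp_neq[OF lam_pos[of n]] by (simp add: c_def)
  have p: "p n + c n * spow (q - 1) (p n) = b n" for n
    using tikhonov(2)[OF \<alpha> b] by (simp add: p_def c_def)
  have p2: "p2 n + c n * spow (q - 1) (p2 n) = 2 * b n - p n" for n
    using bregman_iterate2(2)[OF \<alpha> b] by (simp add: p_def p2_def c_def)
  define g where "g n = (b n - p n) * (b n - p2 n)" for n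
  have g_sums: "g sums (\<alpha> * psi_HR A q b \<alpha>)"
    unfolding g_def[abs_def] p_def p2_def by (rule hanke_raus_sums[OF \<alpha> b])
  have g0: "0 \<le> g n" for n
    unfolding g_def by (rule hanke_raus_term_bounds(1)[OF r c p p2])
  have "sum g {n} \<le> suminf g"
    using g_sums g0 by (intro sum_le_suminf) (auto simp: sums_iff)
  then have g_le: "g n \<le> \<alpha> * psi_HR A q b \<alpha>"
    using g_sums by (simp add: sums_iff)
  have \<theta>: "c n * \<bar>b n\<bar> powr (q - 1 - 1) = \<alpha> * \<tau> n"
    by (simp add: c_def \<tau>_def)
  have \<tau>: "0 \<le> \<tau> n" by (simp add: \<tau>_def)
  have "\<alpha> * (min (q - 1) 1 * \<alpha>\<^sup>2 * \<tau> n ^ 3 * (b n)\<^sup>2) = min (q - 1) 1 * (\<alpha> * \<tau> n) ^ 3 * (b n)\<^sup>2"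
    by (simp add: power2_eq_square power3_eq_cube)
  also have "\<dots> \<le> g n * (1 + max 2 (q - 1) * (\<alpha> * \<tau> n)) ^ 3"
    using hanke_raus_term_bounds(3)[OF r c p p2, of n] unfolding \<theta> g_def .
  also have "\<dots> \<le> (\<alpha> * psi_HR A q b \<alpha>) * (1 + max 2 (q - 1) * (\<alpha> * \<tau> n)) ^ 3"
    using g_le \<tau> \<alpha> by (intro mult_right_mono zero_le_power add_nonneg_nonneg mult_nonneg_nonneg) auto
  finally have "\<alpha> * (min (q - 1) 1 * \<alpha>\<^sup>2 * \<tau> n ^ 3 * (b n)\<^sup>2)
      \<le> \<alpha> * (psi_HR A q b \<alpha> * (1 + max 2 (q - 1) * \<alpha> * \<tau> n) ^ 3)"
    by (simp add: mult.assoc)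
  then show ?thesis using \<alpha> by simp
qed

text \<open>The Bregman distance is at most the symmetric one, by the tangent inequality at the
  Tikhonov minimiser. The latter is rewritten in the image variables, where the scalar estimates
  apply.\<close>

lemma bregman_le_sum:
  assumes \<alpha>: "0 < \<alpha>" and b: "b \<in> lq 2" and w: "w \<in> lq 2" and x': "x' \<in> lq q"
    and sub: "dual_adjoint A w \<in> subdiff q x'"
  defines "f \<equiv> \<lambda>n. (\<alpha> / lam n powr q * spow (q - 1) (lam n * tikhonov A q b \<alpha> n)
      - \<alpha> / lam n powr q * spow (q - 1) (A x' n)) * (lam n * tikhonov A q b \<alpha> n - A x' n)"
  assumes f: "summable f"
  shows "\<alpha> * bregman q (dual_adjoint A w) (tikhonov A q b \<alpha>) x' \<le> suminf f"
proof -
  let ?x = "tikhonov A q b \<alpha>"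
  note x = tikhonov(1)[OF \<alpha> b]
  have q0: "0 < q" using q1 by simp
  have xx': "?x - x' \<in> lq q" by (intro lq_diff q0 x x')
  define h where "h n = \<alpha> * ((\<bar>?x n\<bar> powr q / q - \<bar>x' n\<bar> powr q / q) - w n * A (?x - x') n)" for n
  have reg_sums: "(\<lambda>n. \<bar>z n\<bar> powr q / q) sums reg q z" if "z \<in> lq q" for z
    using that q0 by (simp add: reg_eq lq_def sums_divide summable_sums)
  have "h sums (\<alpha> * bregman q (dual_adjoint A w) ?x x')"
    unfolding h_def[abs_def] bregman_def dual_adjoint_def l2_inner_def
    by (intro sums_mult sums_diff reg_sums x x' summable_sums summable_mult_lq_2 w A_mem xx')
  moreover have "h n \<le> f n" for n
  proof -
    have l: "0 < lam n" by (rule lam_pos)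
    have "\<bar>?x n\<bar> powr q / q - \<bar>x' n\<bar> powr q / q \<le> spow (q - 1) (?x n) * (?x n - x' n)"
      using powr_tangent_le[OF q1, of "?x n" "x' n"] by (simp add: right_diff_distrib)
    moreover have "w n * A (?x - x') n = spow (q - 1) (x' n) * (?x n - x' n)"
      unfolding A_apply[OF xx'] subdiff_adjoint[OF x' w sub, symmetric] by simp
    ultimately have "h n \<le> \<alpha> * ((spow (q - 1) (?x n) - spow (q - 1) (x' n)) * (?x n - x' n))"
      unfolding h_def using \<alpha> by (intro mult_left_mono) (auto simp: left_diff_distrib)
    also have "\<dots> = f n"
    proof -
      \<comment> \<open>Homogeneity leaves \<open>1 / lam n\<close>, which cancels the
        \<open>lam n\<close> in the difference of the image entries.\<close>
      have *: "\<alpha> / lam n powr q * spow (q - 1) (lam n * t) = \<alpha> / lam n * spow (q - 1) t" for t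
        using l by (simp add: spow_mult_pos powr_diff)
      show ?thesis
        unfolding f_def A_apply[OF x'] * using l by (simp add: field_simps)
    qed
    finally show ?thesis .
  qed
  ultimately show ?thesis
    using sums_le[of h f] f by (simp add: sums_iff)
qed

text \<open>The sum of \<open>f\<close> is split along \<open>S\<close>. There \<open>f\<close> is
  bounded by noise and source, and \<open>noise_small\<close> returns the noise to the Hanke-Raus
  terms. Off \<open>S\<close> the weighted noise \<open>e\<close> appears, whose sum the noise
  condition bounds by \<open>C2\<close> times the noise on \<open>S\<close>.\<close>

lemma error_bound:
  assumes \<alpha>: "0 < \<alpha>" and b: "b \<in> lq 2" and w: "w \<in> lq 2" and x': "x' \<in> lq q"
    and sub: "dual_adjoint A w \<in> subdiff q x'"
    and C1: "0 < C1" and C2: "0 < C2"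
    and noise: "noise_condition q lam C1 C2 (A x') b \<alpha>"
  defines "K \<equiv> max 2 (q - 1)" and "B \<equiv> 4 * (C1 + max 2 (q - 1)) ^ 3 / min (q - 1) 1"
  shows "bregman q (dual_adjoint A w) (tikhonov A q b \<alpha>) x'
    \<le> (2 + 16 * K * C2) * B * psi_HR A q b \<alpha>
      + ((2 + 16 * K * C2) * (4 * C1\<^sup>2) + (2 + 4 * K / C1)) * (\<alpha> * (lq_norm 2 w)\<^sup>2)"
proof -
  define y where "y = A x'"
  define p where "p n = lam n * tikhonov A q b \<alpha> n" for n
  define p2 where "p2 n = lam n * bregman_iterate2 A q b \<alpha> n" for n
  define c where "c n = \<alpha> / lam n powr q" for n
  define m where "m n = max \<bar>y n\<bar> \<bar>b n\<bar>" for n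
  define f where "f n = (c n * spow (q - 1) (p n) - c n * spow (q - 1) (y n)) * (p n - y n)" for n
  define d where "d n = (b n - y n)\<^sup>2" for n
  define u where "u n = \<alpha>\<^sup>2 * (w n)\<^sup>2" for n
  define g where "g n = (b n - p n) * (b n - p2 n)" for n
  define e where "e n = c n * m n powr (q - 2) * d n" for n
  define S where "S = {n. lam n powr q / \<alpha> * m n powr (2 - q) < C1}"
  define dS where "dS n = (if n \<in> S then d n else 0)" for n
  define eL where "eL n = (if n \<in> - S then e n else 0)" for n
  have y: "y \<in> lq 2" unfolding y_def by (rule A_mem[OF x'])
  have r: "0 < q - 1" using q1 by simp
  have l: "0 < lam n powr q" for n using less_imp_neq[OF lam_pos[of n]] by simp
  have c: "0 < c n" for n using \<alpha> l by (simp add: c_def)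
  have K: "0 < K" by (simp add: K_def)
  have B: "0 \<le> B" using q1 C1 by (simp add: B_def)
  have p: "p n + c n * spow (q - 1) (p n) = b n" for n
    using tikhonov(2)[OF \<alpha> b] by (simp add: p_def c_def)
  have p2: "p2 n + c n * spow (q - 1) (p2 n) = 2 * b n - p n" for n
    using bregman_iterate2(2)[OF \<alpha> b] by (simp add: p_def p2_def c_def)
  have cu: "c n * spow (q - 1) (y n) = \<alpha> * w n" for n
  proof -
    have "spow (q - 1) (y n) = lam n powr (q - 1) * (lam n * w n)"
      unfolding y_def A_apply[OF x'] subdiff_adjoint[OF x' w sub] by (simp add: spow_mult_pos lam_pos)
    also have "\<dots> = lam n powr q * w n"
      using lam_pos[of n] by (simp add: powr_diff)
    finally show ?thesis using l[of n] by (simp add: c_def)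
  qed
  have u_eq: "(c n * spow (q - 1) (y n))\<^sup>2 = u n" for n
    by (simp add: cu u_def power_mult_distrib)
  have nonneg: "0 \<le> d n" "0 \<le> u n" "0 \<le> e n" for n
    using c[of n] by (simp_all add: d_def u_def e_def)
  have d_sm: "summable d"
    using lq_diff[OF _ b y] by (simp add: lq_2_iff d_def[abs_def])
  have u_sums: "u sums (\<alpha>\<^sup>2 * (lq_norm 2 w)\<^sup>2)"
    unfolding u_def[abs_def] lq_norm_2_sq[OF w] using w by (intro sums_mult summable_sums) (simp add: lq_2_iff)
  have g_sums: "g sums (\<alpha> * psi_HR A q b \<alpha>)"
    unfolding g_def[abs_def] p_def p2_def by (rule hanke_raus_sums[OF \<alpha> b])
  have g0: "0 \<le> g n" for n
    unfolding g_def by (rule hanke_raus_term_bounds(1)[OF r c p p2])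
  have ratio: "lam n powr q / \<alpha> * m n powr (2 - q) = m n powr (2 - q) / c n" for n
    by (simp add: c_def)
  have S: "d n \<le> B * g n + 4 * C1\<^sup>2 * u n" if "n \<in> S" for n
  proof -
    have "m n powr (2 - q) < C1 * c n"
      using that c[of n] unfolding S_def ratio by (simp add: divide_less_eq)
    then show ?thesis
      unfolding m_def d_def B_def g_def u_eq[symmetric] by (rule noise_small[OF q1 c C1 p p2])
  qed
  \<comment> \<open>As \<open>0 powr (2 - q)\<close> defaults to 0, indices with zero data belong to
    \<open>S\<close>.\<close>
  have m_pos: "0 < m n" if "n \<notin> S" for n
  proof (rule ccontr)
    assume "\<not> 0 < m n"
    moreover have "0 \<le> m n" by (simp add: m_def le_max_iff_disj)
    ultimately have "m n = 0" by simp
    then show False using that C1 by (simp add: S_def)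
  qed
  \<comment> \<open>This supplies the constant \<open>T = 1 / C1\<close> for
    \<open>shrink_bregman_large\<close>.\<close>
  have \<theta>: "c n * m n powr (q - 2) \<le> 1 / C1" if "n \<notin> S" for n
  proof -
    have 1: "C1 * c n \<le> m n powr (2 - q)"
      using that c[of n] unfolding S_def ratio by (simp add: not_less le_divide_eq)
    have "C1 * (c n * m n powr (q - 2)) \<le> m n powr (2 - q) * m n powr (q - 2)"
      using mult_right_mono[OF 1, of "m n powr (q - 2)"] by (simp add: mult.assoc)
    also have "\<dots> = 1" using m_pos[OF that] by (simp flip: powr_add)
    finally show ?thesis using C1 by (simp add: field_simps)
  qed
  have f_all: "f n \<le> 2 * d n + 2 * u n" for n
  proof -
    have eq: "p n + c n * spow (q - 1) (p n) - (y n + c n * spow (q - 1) (y n)) = (b n - y n) - \<alpha> * w n"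
      unfolding p cu by simp
    have "\<bar>p n - y n\<bar> \<le> \<bar>(b n - y n) - \<alpha> * w n\<bar>"
      "\<bar>c n * spow (q - 1) (p n) - c n * spow (q - 1) (y n)\<bar> \<le> \<bar>(b n - y n) - \<alpha> * w n\<bar>"
      unfolding eq[symmetric] by (rule shrink_diff[OF r c])+
    then have "\<bar>f n\<bar> \<le> \<bar>(b n - y n) - \<alpha> * w n\<bar> * \<bar>(b n - y n) - \<alpha> * w n\<bar>"
      unfolding f_def abs_mult by (intro mult_mono) auto
    also have "\<dots> = ((b n - y n) - \<alpha> * w n)\<^sup>2" by (simp add: power2_eq_square)
    also have "\<dots> \<le> 2 * (b n - y n)\<^sup>2 + 2 * (\<alpha> * w n)\<^sup>2" by (rule sq_diff_le)
    finally show ?thesis by (simp add: d_def u_def power_mult_distrib)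
  qed
  have f0: "0 \<le> f n" for n
  proof -
    have "p n \<le> y n \<and> spow (q - 1) (p n) \<le> spow (q - 1) (y n)
        \<or> y n \<le> p n \<and> spow (q - 1) (y n) \<le> spow (q - 1) (p n)"
      using spow_mono[OF r] by (metis linear)
    then show ?thesis
      using c[of n] unfolding f_def right_diff_distrib[symmetric]
      by (auto simp: zero_le_mult_iff mult_le_0_iff)
  qed
  have f_sm: "summable f"
  proof (rule summable_comparison_test'[of "\<lambda>n. 2 * d n + 2 * u n" 0])
    show "summable (\<lambda>n. 2 * d n + 2 * u n)"
      using d_sm u_sums by (intro summable_add summable_mult) (auto simp: sums_iff)
  qed (use f_all f0 in auto)
  have f_L: "f n \<le> 16 * K * e n + 4 * K / C1 * u n" if "n \<notin> S" for n
  proof -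
    have "f n \<le> 16 * K * e n + 4 * K * (1 / C1) * u n"
      unfolding f_def K_def e_def d_def m_def u_eq[symmetric]
      by (rule shrink_bregman_large[OF q1 c p \<theta>[OF that, unfolded m_def] m_pos[OF that, unfolded m_def]])
    then show ?thesis by simp
  qed
  have dS_sm: "summable dS" unfolding dS_def[abs_def] by (intro summable_if d_sm nonneg)
  have eL_sm: "summable eL"
  proof (rule summable_comparison_test'[of "\<lambda>n. 1 / C1 * d n" 0])
    fix n
    show "norm (eL n) \<le> 1 / C1 * d n"
      using \<theta>[of n] nonneg(1,3)[of n] C1 mult_right_mono[OF \<theta>[of n] nonneg(1)[of n]]
      by (auto simp: eL_def e_def)
  qed (intro summable_mult d_sm)
  have L_eq: "{n. lam n powr q / \<alpha> * max \<bar>y n\<bar> \<bar>b n\<bar> powr (2 - q) \<ge> C1} = - S"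
    and S_eq: "{n. lam n powr q / \<alpha> * max \<bar>y n\<bar> \<bar>b n\<bar> powr (2 - q) < C1} = S"
    unfolding S_def m_def Collect_neg_eq[symmetric] not_less by (rule refl)+
  have e_eq: "\<bar>y n - b n\<bar>\<^sup>2 * max \<bar>y n\<bar> \<bar>b n\<bar> powr (q - 2) * (\<alpha> / lam n powr q) = e n"
    and d_eq: "\<bar>y n - b n\<bar>\<^sup>2 = d n" for n
    by (simp_all add: e_def d_def c_def m_def power2_commute[of "y n"])
  have "infsum e (- S) \<le> C2 * infsum d S"
    using noise unfolding noise_condition_def Let_def y_def[symmetric] L_eq S_eq e_eq unfolding d_eq .
  moreover have "infsum e (- S) = suminf eL"
    unfolding eL_def[abs_def] by (rule infsum_eq_suminf_if) (use eL_sm nonneg in \<open>auto simp: eL_def[abs_def]\<close>)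
  moreover have "infsum d S = suminf dS"
    unfolding dS_def[abs_def] by (rule infsum_eq_suminf_if) (use dS_sm nonneg in \<open>auto simp: dS_def[abs_def]\<close>)
  ultimately have eL_le: "suminf eL \<le> C2 * suminf dS" by simp
  have f_le: "f n \<le> 2 * dS n + 16 * K * eL n + (2 + 4 * K / C1) * u n" for n
  proof -
    have "0 \<le> 4 * K / C1 * u n" using K C1 nonneg(2)[of n] by simp
    then show ?thesis
      using f_all[of n] f_L[of n] nonneg(2)[of n] unfolding dS_def eL_def distrib_right
      by (cases "n \<in> S") simp_all
  qed
  have "suminf f \<le> 2 * suminf dS + 16 * K * suminf eL + (2 + 4 * K / C1) * (\<alpha>\<^sup>2 * (lq_norm 2 w)\<^sup>2)"
    by (rule sums_le[OF f_le summable_sums[OF f_sm]])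
       (intro sums_add sums_mult summable_sums dS_sm eL_sm u_sums)
  also have "\<dots> \<le> 2 * suminf dS + 16 * K * (C2 * suminf dS) + (2 + 4 * K / C1) * (\<alpha>\<^sup>2 * (lq_norm 2 w)\<^sup>2)"
    using eL_le K by (intro add_mono mult_left_mono order.refl) auto
  also have "\<dots> = (2 + 16 * K * C2) * suminf dS + (2 + 4 * K / C1) * (\<alpha>\<^sup>2 * (lq_norm 2 w)\<^sup>2)"
    by (simp add: algebra_simps)
  also have "suminf dS \<le> B * (\<alpha> * psi_HR A q b \<alpha>) + 4 * C1\<^sup>2 * (\<alpha>\<^sup>2 * (lq_norm 2 w)\<^sup>2)"
  proof (rule sums_le[OF _ summable_sums[OF dS_sm]])
    show "(\<lambda>n. B * g n + 4 * C1\<^sup>2 * u n) sums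
        (B * (\<alpha> * psi_HR A q b \<alpha>) + 4 * C1\<^sup>2 * (\<alpha>\<^sup>2 * (lq_norm 2 w)\<^sup>2))"
      by (intro sums_add sums_mult g_sums u_sums)
    show "dS n \<le> B * g n + 4 * C1\<^sup>2 * u n" for n
      using S[of n] B g0[of n] nonneg(2)[of n] by (auto simp: dS_def)
  qed
  finally have f_suminf: "suminf f \<le> (2 + 16 * K * C2) * (B * (\<alpha> * psi_HR A q b \<alpha>) + 4 * C1\<^sup>2 * (\<alpha>\<^sup>2 * (lq_norm 2 w)\<^sup>2))
      + (2 + 4 * K / C1) * (\<alpha>\<^sup>2 * (lq_norm 2 w)\<^sup>2)"
    using K C2 by (simp add: mult_left_mono)
  have "\<alpha> * bregman q (dual_adjoint A w) (tikhonov A q b \<alpha>) x' \<le> suminf f"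
    using bregman_le_sum[OF \<alpha> b w x' sub] f_sm
    unfolding f_def[abs_def] p_def c_def y_def by simp
  also note f_suminf
  also have "(2 + 16 * K * C2) * (B * (\<alpha> * psi_HR A q b \<alpha>) + 4 * C1\<^sup>2 * (\<alpha>\<^sup>2 * (lq_norm 2 w)\<^sup>2))
      + (2 + 4 * K / C1) * (\<alpha>\<^sup>2 * (lq_norm 2 w)\<^sup>2)
    = \<alpha> * ((2 + 16 * K * C2) * B * psi_HR A q b \<alpha>
      + ((2 + 16 * K * C2) * (4 * C1\<^sup>2) + (2 + 4 * K / C1)) * (\<alpha> * (lq_norm 2 w)\<^sup>2))"
    unfolding power2_eq_square[of \<alpha>] by (simp only: distrib_left distrib_right mult_ac)
  finally show ?thesis using \<alpha> by (simp only: mult_le_cancel_left_pos)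
qed

subsection \<open>Convergence of the Hanke-Raus rule\<close>

lemma hanke_raus_convergence:
  assumes amax: "0 < alpha_max" and w: "w \<in> lq 2" and C1: "0 < C1" and C2: "0 < C2"
    and xdag: "xdag \<in> lq q" and sub: "dual_adjoint A w \<in> subdiff q xdag"
    and yd: "\<And>\<delta>. 0 < \<delta> \<Longrightarrow> yd \<delta> \<in> lq 2" "\<And>\<delta>. 0 < \<delta> \<Longrightarrow> lq_norm 2 (yd \<delta> - A xdag) \<le> \<delta>"
    and arg_min: "\<And>\<delta>. 0 < \<delta> \<Longrightarrow>
      is_arg_min (psi_HR A q (yd \<delta>)) (\<lambda>\<alpha>. \<alpha> \<in> {0<..<alpha_max}) (a \<delta>)"
    and noise: "\<And>\<delta> \<alpha>. 0 < \<delta> \<Longrightarrow> \<alpha> \<in> {0<..<alpha_max} \<Longrightarrow>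
      noise_condition q lam C1 C2 (A xdag) (yd \<delta>) \<alpha>"
  shows "((\<lambda>\<delta>. bregman q (dual_adjoint A w) (tikhonov A q (yd \<delta>) (a \<delta>)) xdag) \<longlongrightarrow> 0) (at_right 0)"
proof -
  define y where "y = A xdag"
  have y: "y \<in> lq 2" unfolding y_def by (rule A_mem[OF xdag])
  define D where "D \<delta> = bregman q (dual_adjoint A w) (tikhonov A q (yd \<delta>) (a \<delta>)) xdag" for \<delta>
  define W where "W = (lq_norm 2 w)\<^sup>2"
  define K where "K = max 2 (q - 1)"
  define k where "k = min (q - 1) 1"
  have k: "0 < k" using q1 by (simp add: k_def)
  have a: "0 < a \<delta>" "a \<delta> < alpha_max" if "0 < \<delta>" for \<delta>
    using arg_min[OF that] by (auto simp: is_arg_min_def)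
  have a_min: "psi_HR A q (yd \<delta>) (a \<delta>) \<le> psi_HR A q (yd \<delta>) \<alpha>"
    if "0 < \<delta>" "0 < \<alpha>" "\<alpha> < alpha_max" for \<delta> \<alpha>
    using arg_min[OF that(1)] that(2,3) unfolding is_arg_min_def
    by (meson greaterThanLessThan_iff not_le)
  have source: "spow (q - 1) (y n) = lam n powr q * w n" for n
  proof -
    have "spow (q - 1) (y n) = lam n powr (q - 1) * (lam n * w n)"
      unfolding y_def A_apply[OF xdag] subdiff_adjoint[OF xdag w sub]
      by (simp add: spow_mult_pos lam_pos)
    then show ?thesis using lam_pos[of n] by (simp add: powr_diff)
  qed
  \<comment> \<open>The trial value \<delta> is admissible once it is below
    \<open>alpha_max\<close>; it makes noise and source terms both of order
    \<open>\<delta>\<^sup>2\<close>, leaving order \<delta> after division.\<close>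
  have psi_le: "psi_HR A q (yd \<delta>) (a \<delta>) \<le> (2 + 8 * W) * \<delta>" if "0 < \<delta>" "\<delta> < alpha_max" for \<delta>
  proof -
    have "\<delta> * psi_HR A q (yd \<delta>) \<delta> \<le> 2 * (lq_norm 2 (yd \<delta> - y))\<^sup>2 + 8 * \<delta>\<^sup>2 * W"
      unfolding W_def by (rule hanke_raus_upper[OF that(1) yd(1)[OF that(1)] y w source])
    also have "(lq_norm 2 (yd \<delta> - y))\<^sup>2 \<le> \<delta>\<^sup>2"
      using yd(2)[OF that(1)] unfolding y_def[symmetric] by (intro power_mono lq_norm_nonneg)
    also have "2 * \<delta>\<^sup>2 + 8 * \<delta>\<^sup>2 * W = \<delta> * ((2 + 8 * W) * \<delta>)"
      by (simp add: power2_eq_square algebra_simps)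
    finally have "psi_HR A q (yd \<delta>) \<delta> \<le> (2 + 8 * W) * \<delta>"
      using that(1) by simp
    then show ?thesis using a_min[OF that(1) that] by simp
  qed
  have small: "\<forall>\<^sub>F \<delta> in at_right 0. 0 < \<delta> \<and> \<delta> < alpha_max"
    using eventually_at_right_less[of 0] eventually_at_right_real[OF amax]
    by eventually_elim auto
  \<comment> \<open>The parameter enters the error bound only through this product, so
    \<open>W = 0\<close> settles the case of zero exact data.\<close>
  have aW: "((\<lambda>\<delta>. a \<delta> * W) \<longlongrightarrow> 0) (at_right 0)"
  proof (cases "\<forall>n. y n = 0")
    case True
    have "w n = 0" for n
      using source[of n] True lam_pos[of n] by simp
    then have "W = 0" unfolding W_def lq_norm_2_sq[OF w] by simp
    then show ?thesis by simp
  next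
    case False
    then obtain n where n: "y n \<noteq> 0" by blast
    have ydn: "((\<lambda>\<delta>. yd \<delta> n) \<longlongrightarrow> y n) (at_right 0)"
    proof -
      have "\<forall>\<^sub>F \<delta> in at_right 0. norm (yd \<delta> n - y n) \<le> \<delta>"
        using small
      proof eventually_elim
        case (elim \<delta>)
        then have "yd \<delta> - y \<in> lq 2" by (intro lq_diff yd y) auto
        from abs_le_lq_norm_2[OF this, of n] yd(2)[of \<delta>] elim show ?case by (simp add: y_def)
      qed
      then have "((\<lambda>\<delta>. yd \<delta> n - y n) \<longlongrightarrow> 0) (at_right 0)"
        by (rule Lim_null_comparison) (rule tendsto_ident_at)
      then show ?thesis by (rule LIM_zero_cancel)
    qed
    define \<tau> where "\<tau> \<delta> = \<bar>yd \<delta> n\<bar> powr (q - 2) / lam n powr q" for \<delta>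
    define \<tau>0 where "\<tau>0 = \<bar>y n\<bar> powr (q - 2) / lam n powr q"
    \<comment> \<open>Solves \<open>hanke_raus_lower\<close> for
      \<open>(a \<delta>)\<^sup>2\<close>, with \<open>alpha_max\<close> in place of
      \<open>a \<delta>\<close> in the cubic factor. Everything but the factor \<delta> has a finite
      limit because \<open>\<tau>0\<close> and \<open>y n\<close> are nonzero.\<close>
    define E where "E \<delta> = (2 + 8 * W) * \<delta> * (1 + K * alpha_max * \<tau> \<delta>) ^ 3 / (k * \<tau> \<delta> ^ 3 * (yd \<delta> n)\<^sup>2)" for \<delta>
    have l: "lam n \<noteq> 0" using lam_pos[of n] by simp
    have \<tau>: "(\<tau> \<longlongrightarrow> \<tau>0) (at_right 0)"
      unfolding \<tau>_def[abs_def] \<tau>0_def using n l by (intro tendsto_intros ydn) auto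
    have "\<tau>0 \<noteq> 0" using n l by (simp add: \<tau>0_def)
    then have "(E \<longlongrightarrow> (2 + 8 * W) * 0 * (1 + K * alpha_max * \<tau>0) ^ 3 / (k * \<tau>0 ^ 3 * (y n)\<^sup>2)) (at_right 0)"
      unfolding E_def[abs_def] using n k by (intro tendsto_intros \<tau> ydn) auto
    then have "((\<lambda>\<delta>. sqrt (E \<delta>)) \<longlongrightarrow> sqrt 0) (at_right 0)"
      by (intro tendsto_real_sqrt) simp
    then have sqrt_E: "((\<lambda>\<delta>. sqrt (E \<delta>)) \<longlongrightarrow> 0) (at_right 0)" by simp
    have "\<forall>\<^sub>F \<delta> in at_right 0. yd \<delta> n \<noteq> 0"
      using tendsto_imp_eventually_ne[OF ydn n] .
    with small have "\<forall>\<^sub>F \<delta> in at_right 0. norm (a \<delta>) \<le> sqrt (E \<delta>)"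
    proof eventually_elim
      case (elim \<delta>)
      then have \<delta>: "0 < \<delta>" "\<delta> < alpha_max" and nz: "yd \<delta> n \<noteq> 0" by auto
      have \<tau>_pos: "0 < \<tau> \<delta>" using nz l by (simp add: \<tau>_def)
      have K: "0 < K" by (simp add: K_def)
      have den: "0 < k * \<tau> \<delta> ^ 3 * (yd \<delta> n)\<^sup>2" using k \<tau>_pos nz by simp
      have "k * (a \<delta>)\<^sup>2 * \<tau> \<delta> ^ 3 * (yd \<delta> n)\<^sup>2
          \<le> psi_HR A q (yd \<delta>) (a \<delta>) * (1 + K * a \<delta> * \<tau> \<delta>) ^ 3"
        unfolding k_def K_def \<tau>_def by (rule hanke_raus_lower[OF a(1)[OF \<delta>(1)] yd(1)[OF \<delta>(1)]])
      also have "\<dots> \<le> ((2 + 8 * W) * \<delta>) * (1 + K * alpha_max * \<tau> \<delta>) ^ 3"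
        using psi_le[OF \<delta>] a[OF \<delta>(1)] K \<tau>_pos \<delta>
        by (intro mult_mono power_mono add_left_mono mult_right_mono mult_left_mono)
           (auto simp: W_def intro!: add_nonneg_nonneg mult_nonneg_nonneg)
      finally have "(a \<delta>)\<^sup>2 * (k * \<tau> \<delta> ^ 3 * (yd \<delta> n)\<^sup>2)
          \<le> (2 + 8 * W) * \<delta> * (1 + K * alpha_max * \<tau> \<delta>) ^ 3"
        by (simp add: mult_ac)
      then have "(a \<delta>)\<^sup>2 \<le> E \<delta>"
        unfolding E_def using den by (simp add: le_divide_eq)
      then show ?case using a(1)[OF \<delta>(1)] real_le_rsqrt by simp
    qed
    then have "(a \<longlongrightarrow> 0) (at_right 0)"
      by (rule Lim_null_comparison) (rule sqrt_E)
    then show ?thesis by (rule tendsto_mult_left_zero)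
  qed
  define B where "B = (2 + 16 * K * C2) * (4 * (C1 + max 2 (q - 1)) ^ 3 / min (q - 1) 1)"
  define B' where "B' = (2 + 16 * K * C2) * (4 * C1\<^sup>2) + (2 + 4 * K / C1)"
  have B: "0 \<le> B" using C1 C2 q1 by (simp add: B_def K_def)
  have "((\<lambda>\<delta>. B * ((2 + 8 * W) * \<delta>) + B' * (a \<delta> * W)) \<longlongrightarrow> B * ((2 + 8 * W) * 0) + B' * 0) (at_right 0)"
    by (intro tendsto_intros aW)
  then have lim: "((\<lambda>\<delta>. B * ((2 + 8 * W) * \<delta>) + B' * (a \<delta> * W)) \<longlongrightarrow> 0) (at_right 0)"
    by simp
  have "(D \<longlongrightarrow> 0) (at_right 0)"
  proof (rule tendsto_sandwich[OF _ _ tendsto_const lim])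
    show "\<forall>\<^sub>F \<delta> in at_right 0. 0 \<le> D \<delta>"
      using small
    proof eventually_elim
      case (elim \<delta>)
      then have "tikhonov A q (yd \<delta>) (a \<delta>) \<in> lq q" by (intro tikhonov(1) a yd) auto
      then show ?case using sub by (auto simp: D_def bregman_def subdiff_def algebra_simps)
    qed
    show "\<forall>\<^sub>F \<delta> in at_right 0. D \<delta> \<le> B * ((2 + 8 * W) * \<delta>) + B' * (a \<delta> * W)"
      using small
    proof eventually_elim
      case (elim \<delta>)
      then have \<delta>: "0 < \<delta>" "\<delta> < alpha_max" by auto
      have "a \<delta> \<in> {0<..<alpha_max}" using a[OF \<delta>(1)] by simp
      note noise' = noise[OF \<delta>(1) this]
      have "D \<delta> \<le> B * psi_HR A q (yd \<delta>) (a \<delta>) + B' * (a \<delta> * W)"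
        unfolding D_def B_def B'_def W_def K_def
        by (rule error_bound[OF a(1)[OF \<delta>(1)] yd(1)[OF \<delta>(1)] w xdag sub C1 C2 noise'])
      then show ?case using mult_left_mono[OF psi_le[OF \<delta>] B] by linarith
    qed
  qed
  then show ?thesis by (simp only: D_def[abs_def])
qed

end

section \<open>Convergence under the stated hypotheses\<close>

theorem theorem7:
  fixes q :: real
  assumes "3 / 2 \<le> q"
  shows "\<exists>cbar>0.
    \<forall>(lam :: nat \<Rightarrow> real) (A :: (nat \<Rightarrow> real) \<Rightarrow> nat \<Rightarrow> real) (alpha_max :: real)
      (y :: nat \<Rightarrow> real) (yd :: real \<Rightarrow> nat \<Rightarrow> real) (xdag :: nat \<Rightarrow> real) (w :: nat \<Rightarrow> real)
      (alpha_star :: (nat \<Rightarrow> real) \<Rightarrow> real) (C1 :: real) (C2 :: real).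
      (\<forall>n. lam n > 0) \<and> decseq lam \<and> lam \<longlonglongrightarrow> 0 \<and>
      bounded_operator q 2 A \<and>
      (\<forall>n. A (unit_seq n) = (\<lambda>k. lam n * unit_seq n k)) \<and>
      alpha_max > 0 \<and>
      y \<in> lq 2 \<and>
      is_arg_min (reg q) (\<lambda>x. x \<in> lq q \<and> A x = y) xdag \<and>
      w \<in> lq 2 \<and> dual_adjoint A w \<in> subdiff q xdag \<and>
      (\<forall>\<delta>>0. yd \<delta> \<in> lq 2 \<and> lq_norm 2 (yd \<delta> - y) \<le> \<delta>) \<and>
      (\<forall>\<delta>>0. is_arg_min (psi_HR A q (yd \<delta>)) (\<lambda>\<alpha>. \<alpha> \<in> {0<..<alpha_max}) (alpha_star (yd \<delta>))) \<and>
      (\<forall>\<delta>>0. lq_norm 2 (A (tikhonov A q (yd \<delta>) (alpha_star (yd \<delta>))) - yd \<delta>) \<noteq> 0) \<and>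
      0 < C1 \<and> C1 \<le> cbar \<and> 0 < C2 \<and>
      (\<forall>\<delta>>0. \<forall>\<alpha>\<in>{0<..<alpha_max}. noise_condition q lam C1 C2 y (yd \<delta>) \<alpha>)
      \<longrightarrow>
      ((\<lambda>\<delta>. bregman q (dual_adjoint A w)
               (tikhonov A q (yd \<delta>) (alpha_star (yd \<delta>))) xdag) \<longlongrightarrow> 0) (at_right 0)"
\<comment> \<open>The threshold 1 is a convenient choice; the constants of
  \<open>error_bound\<close> depend explicitly on \<open>C1\<close>.\<close>
proof (intro exI[of _ 1] conjI allI impI)
  fix lam A alpha_max y yd xdag w alpha_star C1 C2
  assume asm: "(\<forall>n. lam n > (0::real)) \<and> decseq lam \<and> lam \<longlonglongrightarrow> 0 \<and>
      bounded_operator q 2 A \<and>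
      (\<forall>n. A (unit_seq n) = (\<lambda>k. lam n * unit_seq n k)) \<and>
      (alpha_max::real) > 0 \<and>
      y \<in> lq 2 \<and>
      is_arg_min (reg q) (\<lambda>x. x \<in> lq q \<and> A x = y) xdag \<and>
      w \<in> lq 2 \<and> dual_adjoint A w \<in> subdiff q xdag \<and>
      (\<forall>\<delta>>0. yd \<delta> \<in> lq 2 \<and> lq_norm 2 (yd \<delta> - y) \<le> \<delta>) \<and>
      (\<forall>\<delta>>0. is_arg_min (psi_HR A q (yd \<delta>)) (\<lambda>\<alpha>. \<alpha> \<in> {0<..<alpha_max}) (alpha_star (yd \<delta>))) \<and>
      (\<forall>\<delta>>0. lq_norm 2 (A (tikhonov A q (yd \<delta>) (alpha_star (yd \<delta>))) - yd \<delta>) \<noteq> 0) \<and>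
      0 < C1 \<and> C1 \<le> 1 \<and> 0 < C2 \<and>
      (\<forall>\<delta>>0. \<forall>\<alpha>\<in>{0<..<alpha_max}. noise_condition q lam C1 C2 y (yd \<delta>) \<alpha>)"
  have lam: "\<forall>n. 0 < lam n" using asm by (elim conjE)
  have bdd: "bounded_operator q 2 A" using asm by (elim conjE)
  have unit: "\<forall>n. A (unit_seq n) = (\<lambda>k. lam n * unit_seq n k)" using asm by (elim conjE)
  have op: "diagonal_operator q lam A"
    by (rule diagonal_operator.intro) (use assms lam bdd unit in simp_all)
  have xdag: "xdag \<in> lq q" "A xdag = y" using asm by (auto simp: is_arg_min_def)
  show "((\<lambda>\<delta>. bregman q (dual_adjoint A w)
               (tikhonov A q (yd \<delta>) (alpha_star (yd \<delta>))) xdag) \<longlongrightarrow> 0) (at_right 0)"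
  proof (rule diagonal_operator.hanke_raus_convergence[OF op _ _ _ _ xdag(1)])
    show "0 < alpha_max" "w \<in> lq 2" "0 < C1" "0 < C2" "dual_adjoint A w \<in> subdiff q xdag"
      using asm by simp_all
    fix \<delta> :: real
    assume \<delta>: "0 < \<delta>"
    show "yd \<delta> \<in> lq 2" "lq_norm 2 (yd \<delta> - A xdag) \<le> \<delta>"
      using asm \<delta> xdag(2) by auto
    show "is_arg_min (psi_HR A q (yd \<delta>)) (\<lambda>\<alpha>. \<alpha> \<in> {0<..<alpha_max}) (alpha_star (yd \<delta>))"
      using asm \<delta> by auto
    show "noise_condition q lam C1 C2 (A xdag) (yd \<delta>) \<alpha>" if "\<alpha> \<in> {0<..<alpha_max}" for \<alpha>
      using asm \<delta> that xdag(2) by auto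
  qed
qed simp

end
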